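(* Let $\widetilde{\mathcal D}\subset\mathbb H$ be a domain satisfying the cone property with aperture $\gamma$, tilt angle function $\omega$ and threshold $\eta_*$, and let $g:\mathbb H\to\mathbb C^{N\times N}$ be an analytic matrix-valued function satisfying the decay condition $\|g(\zeta)\|\lesssim|\operatorname{Im}\zeta|^{-1}$ for $\zeta\in\widetilde{\mathcal D}\cup\{\zeta\in\mathbb H:|\operatorname{Im}\zeta|\ge\eta_*\}$. Then for all $z\in\widetilde{\mathcal D}$ and $\xi\in(0,\operatorname{Im}z)$, $$g(z)=\frac1\pi\int_{\mathbb R}\frac{\operatorname{Im}g(\psi(x))}{x-\psi^{-1}(z)}\,dx,\qquad\operatorname{Im}g:=\tfrac1{2i}(g-g^* ),$$ where $\psi:\overline{\mathbb H}\to\mathbb H$ is defined by $$\psi(u)\equiv\psi_{z,\xi}(u):=z+e^{i\omega(z)}\bigl(-i\xi+e^{i\frac\pi2(1-\gamma)}u^\gamma\bigr),$$ with $u^\gamma:=\exp(\gamma\log u)$ and the branch of $\log$ cut along $[0,-i\infty]$. Moreover, $\psi$ is continuous in $\overline{\mathbb H}$ and maps $\mathbb H$ conformally onto the interior of $\{-ie^{i\omega(z)}\xi\}+\mathbb V_z$ (Minkowski sum). In particular, let $T$ be a fixed terminal time and let $\gamma,\omega$ be an aperture and tilt angle function with which $\mathcal D\cap\mathbb H$ satisfies the cone property. Then for any $N\times N$ matrix $X=X^*$, any $t\in[0,T]$, any $z\in\mathcal D\cap\mathbb H$ and $\xi\in(0,\operatorname{Im}z)$, with $\psi=\psi_{z,\xi}$,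 $$G\bigl(X,\mathfrak f^t(z)\bigr)=\frac1\pi\int_{\mathbb R}\frac{\operatorname{Im}G\bigl(X,(\mathfrak f^t\circ\psi)(x)\bigr)}{x-i\xi^{1/\gamma}}\,dx.$$
   Context: $\mathbb H,\mathbb H^*$ are the open upper and lower half-planes; $\|\cdot\|$ is the operator norm; $\lesssim$ denotes inequality up to a constant (depending only on the model parameters); operations on vectors are entrywise; $\mathbf 1=(1,\dots,1)$. Cone property. A domain $\widetilde{\mathcal D}\subset\mathbb C$ satisfies the cone property if there exist a constant $\gamma$ with $1\lesssim\gamma\le\frac14$ (so $\gamma>0$) and an angle function $\omega:\widetilde{\mathcal D}\to[-\frac\pi2\gamma,\frac\pi2\gamma]$ such that for every $z\in\widetilde{\mathcal D}$ the cone with vertex $z$, aperture angle $\gamma\pi$ and tilt angle $\omega(z)$, $$\mathbb V_z:=\bigl\{\zeta\in\mathbb C:\operatorname{sign}(\operatorname{Im}z)\operatorname{Im}[e^{-i\omega(z)}(\zeta-z)]\ge\cos(\tfrac\pi2\gamma)|\zeta-z|\bigr\},$$ is contained in $\widetilde{\mathcal D}\cup\{\zeta\in\mathbb C:|\operatorname{Im}\zeta|\ge\eta_*\}$ for some threshold $\eta_*>0$. Objects in the second part. $\mathfrak a\in\mathbb R^N$ with $\|\mathfrak a\|_\infty\le C_{\mathfrak a}$ and a symmetric matrix $S$ with nonnegative entries satisfy: $(S^L)_{jk}\ge c_{\inf}/N$, $S_{jk}\le C_{\sup}/N$ for some integer $L$, and the unique solution $\mathbf m(z)$ of $-1/m_j(z)=z-\mathfrak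 a_j+\sum_kS_{jk}m_k(z)$, $(\operatorname{Im}z)\operatorname{Im}m_j(z)>0$, satisfies $\|\mathbf m(z)\|_\infty\le C_{\mathrm m}$ for all $z\in\mathbb C\setminus\mathbb R$. With $\rho(E):=\pi^{-1}\lim_{\eta\to+0}N^{-1}\sum_j\operatorname{Im}m_j(E+i\eta)$ and constants $\rho_*,\eta_*,\varepsilon>0$, $\mathcal D:=\{z\in\mathbb C\setminus\mathbb R:\rho(\operatorname{Re}z)\ge\rho_*,\ N^{-1+\varepsilon}\le|\operatorname{Im}z|\le\eta_*\}$. The model parameters are the constants $C_{\mathfrak a},L,c_{\inf},C_{\sup},C_{\mathrm m},\rho_*,\eta_*$. For $\mathbf z\in\mathbb H^N$, $\mathbf m(\mathbf z)\in\mathbb H^N$ is the unique solution of $-1/\mathbf m(\mathbf z)=\mathbf z-\mathfrak a+S[\mathbf m(\mathbf z)]$, and $\mathbf m(\overline{\mathbf z}):=\overline{\mathbf m(\mathbf z)}$. The flow map is $\mathfrak f^t(z):=\mathbf z_t$, where $\mathbf z_t$, $t\in[0,T]$, is the unique solution of $\partial_t\mathbf z_t=-S[\mathbf m(\mathbf z_t)]-\frac12(\mathbf z_t-\mathfrak a)$ with $\mathbf z_T=z\mathbf 1$. The generalized resolvent is $G(X,\mathbf z):=(X-\operatorname{diag}(\mathbf z))^{-1}$ for $X=X^*$, $\mathbf z\in\mathbb H^N\cup(\mathbb H^* )^N$. *)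

theory Defs
  imports "HOL-Analysis.Analysis" "HOL-Library.Set_Algebras"
begin

definition adj :: "complex^'n^'n \<Rightarrow> complex^'n^'n" where
  "adj A = (\<chi> i j. cnj (A $ j $ i))"

definition cscale :: "complex \<Rightarrow> complex^'n^'n \<Rightarrow> complex^'n^'n" where
  "cscale c A = (\<chi> i j. c * A $ i $ j)"

definition Im_mat :: "complex^'n^'n \<Rightarrow> complex^'n^'n" where
  "Im_mat A = cscale (1 / (2 * \<i>)) (A - adj A)"

text \<open>The norm of the type of matrices is the Frobenius norm; the operator norm is
  taken with respect to the Euclidean norm of \<open>complex^'n\<close>.\<close>

definition op_norm :: "complex^'n^'n \<Rightarrow> real" where
  "op_norm A = onorm (\<lambda>v. A *v v)"

definition uhp :: "complex set" where
  "uhp = {z. 0 < Im z}"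

definition uhp_closed :: "complex set" where
  "uhp_closed = {z. 0 \<le> Im z}"

definition uhp_vec :: "(complex^'n) set" where
  "uhp_vec = {v. \<forall>j. v $ j \<in> uhp}"

definition cnj_vec :: "complex^'n \<Rightarrow> complex^'n" where
  "cnj_vec v = (\<chi> j. cnj (v $ j))"

definition const_vec :: "complex \<Rightarrow> complex^'n" where
  "const_vec z = (\<chi> j. z)"

definition diag_mat :: "complex^'n \<Rightarrow> complex^'n^'n" where
  "diag_mat v = (\<chi> i j. if i = j then v $ i else 0)"

definition analytic_mat :: "(complex \<Rightarrow> complex^'n^'n) \<Rightarrow> complex set \<Rightarrow> bool" where
  "analytic_mat g A \<longleftrightarrow> (\<forall>i j. (\<lambda>\<zeta>. g \<zeta> $ i $ j) holomorphic_on A)"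

definition tilted_cone :: "real \<Rightarrow> real \<Rightarrow> complex \<Rightarrow> complex set" where
  "tilted_cone \<gamma> \<theta> z =
    {\<zeta>. sgn (Im z) * Im (exp (- (\<i> * of_real \<theta>)) * (\<zeta> - z)) \<ge> cos (pi / 2 * \<gamma>) * cmod (\<zeta> - z)}"

definition cone_property ::
  "complex set \<Rightarrow> real \<Rightarrow> (complex \<Rightarrow> real) \<Rightarrow> real \<Rightarrow> bool" where
  "cone_property D \<gamma> \<omega> \<eta> \<longleftrightarrow>
    0 < \<gamma> \<and> \<gamma> \<le> 1 / 4 \<and> 0 < \<eta> \<and>
    (\<forall>z\<in>D. \<omega> z \<in> {- (pi / 2 * \<gamma>) .. pi / 2 * \<gamma>}) \<and>
    (\<forall>z\<in>D. tilted_cone \<gamma> (\<omega> z) z \<subseteq> D \<union> {\<zeta>. \<bar>Im \<zeta>\<bar> \<ge> \<eta>})"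

text \<open>\<open>Ln\<close> is the principal branch, with imaginary part in $(-\pi, \pi]$, so that \<open>log_cut\<close>
  is the logarithm that is real on the positive half-line and cut along the negative imaginary
  half-axis. The power is continued to \<open>0\<close> by continuity.\<close>

definition log_cut :: "complex \<Rightarrow> complex" where
  "log_cut u = Ln (- \<i> * u) + \<i> * of_real (pi / 2)"

definition pow_cut :: "complex \<Rightarrow> real \<Rightarrow> complex" where
  "pow_cut u \<gamma> = (if u = 0 then 0 else exp (of_real \<gamma> * log_cut u))"

definition psi :: "real \<Rightarrow> (complex \<Rightarrow> real) \<Rightarrow> complex \<Rightarrow> real \<Rightarrow> complex \<Rightarrow> complex" where
  "psi \<gamma> \<omega> z \<xi> u =
    z + exp (\<i> * of_real (\<omega> z)) *
      (- \<i> * of_real \<xi> + exp (\<i> * of_real (pi / 2 * (1 - \<gamma>))) * pow_cut u \<gamma>)"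

definition maps_conformally_onto ::
  "(complex \<Rightarrow> complex) \<Rightarrow> complex set \<Rightarrow> complex set \<Rightarrow> bool" where
  "maps_conformally_onto f U V \<longleftrightarrow> f holomorphic_on U \<and> bij_betw f U V"

definition S_apply :: "real^'n^'n \<Rightarrow> complex^'n \<Rightarrow> complex^'n" where
  "S_apply S v = (\<chi> j. \<Sum>k\<in>UNIV. of_real (S $ j $ k) * v $ k)"

definition dyson_eq :: "real^'n \<Rightarrow> real^'n^'n \<Rightarrow> complex^'n \<Rightarrow> complex^'n \<Rightarrow> bool" where
  "dyson_eq a S w m \<longleftrightarrow>
    (\<forall>j. - 1 / m $ j = w $ j - of_real (a $ j) + S_apply S m $ j)"

definition m_scalar :: "real^'n \<Rightarrow> real^'n^'n \<Rightarrow> complex \<Rightarrow> complex^'n" where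
  "m_scalar a S z = (THE m. dyson_eq a S (const_vec z) m \<and> (\<forall>j. Im z * Im (m $ j) > 0))"

text \<open>Only meaningful for vectors whose entries all lie in the upper half-plane or all lie in
  the lower half-plane; in the latter case it is defined by conjugation.\<close>

definition m_vec :: "real^'n \<Rightarrow> real^'n^'n \<Rightarrow> complex^'n \<Rightarrow> complex^'n" where
  "m_vec a S w =
    (if w \<in> uhp_vec then (THE m. m \<in> uhp_vec \<and> dyson_eq a S w m)
     else cnj_vec (THE m. m \<in> uhp_vec \<and> dyson_eq a S (cnj_vec w) m))"

text \<open>The power \<open>S^L\<close> is the iterated matrix product; the library's \<open>*\<close> on matrices is
  entrywise.\<close>

definition model_assumptions ::
  "real^'n \<Rightarrow> real^'n^'n \<Rightarrow> nat \<Rightarrow> real \<Rightarrow> real \<Rightarrow> real \<Rightarrow> real \<Rightarrow> bool" where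
  "model_assumptions a S L C_a c_inf C_sup C_m \<longleftrightarrow>
    0 < c_inf \<and>
    (\<forall>j. \<bar>a $ j\<bar> \<le> C_a) \<and>
    transpose S = S \<and>
    (\<forall>j k. 0 \<le> S $ j $ k) \<and>
    (\<forall>j k. ((\<lambda>A. S ** A) ^^ L) (mat 1) $ j $ k \<ge> c_inf / real CARD('n)) \<and>
    (\<forall>j k. S $ j $ k \<le> C_sup / real CARD('n)) \<and>
    (\<forall>z. Im z \<noteq> 0 \<longrightarrow> (\<forall>j. cmod (m_scalar a S z $ j) \<le> C_m))"

definition scdos :: "real^'n \<Rightarrow> real^'n^'n \<Rightarrow> real \<Rightarrow> real" where
  "scdos a S E =
    Lim (at_right 0) (\<lambda>\<eta>. (\<Sum>j\<in>UNIV. Im (m_scalar a S (Complex E \<eta>) $ j)) / real CARD('n)) / pi"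

definition bulk_domain ::
  "real^'n \<Rightarrow> real^'n^'n \<Rightarrow> real \<Rightarrow> real \<Rightarrow> real \<Rightarrow> complex set" where
  "bulk_domain a S \<rho>s \<eta>s \<epsilon> =
    {z. Im z \<noteq> 0 \<and> scdos a S (Re z) \<ge> \<rho>s \<and>
        real CARD('n) powr (- 1 + \<epsilon>) \<le> \<bar>Im z\<bar> \<and> \<bar>Im z\<bar> \<le> \<eta>s}"

definition flow_solution ::
  "real^'n \<Rightarrow> real^'n^'n \<Rightarrow> real \<Rightarrow> complex \<Rightarrow> (real \<Rightarrow> complex^'n) \<Rightarrow> bool" where
  "flow_solution a S T z Z \<longleftrightarrow>
    (\<forall>t\<in>{0..T}. (Z t \<in> uhp_vec \<or> cnj_vec (Z t) \<in> uhp_vec) \<and>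
      (Z has_vector_derivative
        (- S_apply S (m_vec a S (Z t)) - (1 / 2) *\<^sub>R (Z t - (\<chi> j. of_real (a $ j)))))
        (at t within {0..T})) \<and>
    Z T = const_vec z"

text \<open>A solution is only determined on $[0,T]$, so uniqueness is expressed for its value at
  time \<open>t\<close>.\<close>

definition flow_map ::
  "real^'n \<Rightarrow> real^'n^'n \<Rightarrow> real \<Rightarrow> real \<Rightarrow> complex \<Rightarrow> complex^'n" where
  "flow_map a S T t z = (THE w. \<exists>Z. flow_solution a S T z Z \<and> Z t = w)"

definition gen_resolvent :: "complex^'n^'n \<Rightarrow> complex^'n \<Rightarrow> complex^'n^'n" where
  "gen_resolvent X w = matrix_inv (X - diag_mat w)"

end

theory Submission
  imports Defs "HOL-Complex_Analysis.Cauchy_Integral_Formula" "HOL-Real_Asymp.Real_Asymp"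
begin

text \<open>Let \<open>h = g \<circ> \<psi>\<close>. Up to a rotation and a translation \<open>\<psi>(u)\<close> is \<open>u\<^sup>\<gamma>\<close>, and since \<open>\<gamma> \<le> 1/4\<close>
and \<open>\<bar>\<omega>\<bar> \<le> \<pi>\<gamma>/2\<close> the cone stays within an angle \<open>\<pi>/4\<close> of the vertical. Hence
\<open>Im \<psi>(u) \<ge> Im z - \<xi> + \<bar>u\<bar>\<^sup>\<gamma>/2\<close> (\<open>Im_psi_ge\<close>), and the decay of \<open>g\<close> turns into
\<open>\<parallel>h(u)\<parallel> \<le> B (1 + \<bar>u\<bar>)\<^sup>-\<^sup>\<gamma>\<close> on the closed half-plane (\<open>decay_along_psi\<close>): only a bounded
set of \<open>u\<close> is mapped below the threshold, and there continuity gives a bound. This polynomial decay makes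
\<open>h(x)/(x - w)\<close> integrable and lets the arcs in Cauchy's formula disappear. Let
\<open>w = \<psi>\<^sup>-\<^sup>1(z) = \<i> \<xi>\<^sup>1\<^sup>/\<^sup>\<gamma>\<close>. Then \<open>\<integral> h(x)/(x - w) dx = 2\<pi>\<i> h(w)\<close>, while
\<open>\<integral> h(x)/(x - cnj w) dx = 0\<close> because \<open>cnj w\<close> lies outside. Taking adjoints in the second identity and
subtracting it from the first replaces \<open>h\<close> by \<open>h - h\<^sup>* = 2\<i> Im h\<close>, which is the formula
(\<open>cone_integral_representation\<close>).

For the resolvent the formula is applied to \<open>g(\<zeta>) = G(X, \<ff>\<^sup>t(\<zeta>))\<close>, so the flow map must be shown to
exist, to be holomorphic in \<open>\<zeta>\<close>, and not to decrease imaginary parts. The point is that the flow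
becomes linear in the variable \<open>m\<close>. The Dyson equation says that the spectral parameter is an
explicit function \<open>\<Phi>(m) = \<aa> - 1/m - S m\<close> of its solution, and \<open>-S m - (\<Phi>(m) - \<aa>)/2\<close> is
exactly the derivative of \<open>\<Phi>\<close> at \<open>m\<close> in direction \<open>m/2\<close>. So \<open>m\<^sub>t = m(\<z>\<^sub>t)\<close> satisfies \<open>m\<^sub>t' = m\<^sub>t/2\<close>,
whence \<open>m\<^sub>t = e\<^bsup>(t-T)/2\<^esup> m(z)\<close> and \<open>\<ff>\<^sup>t(z) = \<Phi>(m\<^sub>t)\<close>; existence and uniqueness of the flow both
follow (\<open>flow_solution_char_flow\<close>, \<open>flow_solution_unique\<close>).

This rests on three facts about the Dyson equation with nonnegative \<open>S\<close>. A solution exists for every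
parameter in \<open>\<H>\<^sup>N\<close> by Brouwer's theorem (\<open>dyson_solution_exists\<close>). Solutions obey a Schwarz-Pick
inequality (\<open>dyson_Schwarz_Pick\<close>), which gives uniqueness and continuity. The derivative of \<open>\<Phi>\<close> is
injective at solutions (\<open>dyson_param_deriv_eq_0\<close>), so that \<open>m\<close> is differentiable, and holomorphic
along \<open>\<zeta>\<one>\<close>. Finally \<open>\<parallel>G(X,\<z>)\<parallel> \<le> 1/min Im \<z>\<^sub>j\<close>, and \<open>Im \<ff>\<^sup>t(\<zeta>) \<ge> Im \<zeta>\<close> because scaling \<open>m\<close>
by a factor in \<open>(0,1]\<close> only increases \<open>Im \<Phi>\<close>.\<close>

no_notation fps_nth (infixl \<open>$\<close> 75)

section \<open>The Cauchy formula on the upper half-plane\<close>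

text \<open>The full circle winds once around \<open>w\<close>. It is the sum of the boundary of the upper and of the lower
half-disc, since the two diameters cancel, and the lower half-disc does not contain \<open>w\<close>.\<close>

lemma winding_number_upper_semicircle:
  assumes "0 < Im w" "cmod w < R"
  shows "winding_number (part_circlepath 0 R 0 pi +++ linepath (of_real (-R)) (of_real R)) w = 1"
proof -
  define A where "A = part_circlepath 0 R 0 pi"
  define B where "B = part_circlepath 0 R pi (2*pi)"
  define l where "l = linepath (of_real R) (of_real (-R) :: complex)"
  have R: "R > 0" using assms(2) norm_ge_zero[of w] by linarith
  have on_circle: "path_image (part_circlepath 0 R s t) \<subseteq> sphere 0 R" for s t
    using R by (auto simp: path_image_def part_circlepath_def norm_mult)
  have lower: "Im x \<le> 0" if "x \<in> path_image B" for x
  proof -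
    from that obtain t where t: "t \<in> {0..1}" "x = part_circlepath 0 R pi (2*pi) t"
      unfolding B_def path_image_def by blast
    have "linepath pi (2*pi) t = pi + t * pi" by (simp add: linepath_def algebra_simps)
    hence "Im x = R * sin (pi + t * pi)"
      using t(2) by (simp add: part_circlepath_def Im_exp)
    moreover have "sin (t*pi) \<ge> 0" using t by (intro sin_ge_zero) auto
    ultimately show ?thesis using R by (simp add: sin_add mult_nonneg_nonneg)
  qed
  have segreal: "Im x = 0" if "x \<in> path_image l" for x
    using that by (auto simp: l_def in_segment)
  have wA: "w \<notin> path_image A" using on_circle assms(2) unfolding A_def by fastforce
  have wB: "w \<notin> path_image B" using on_circle assms(2) unfolding B_def by fastforce
  have wl: "w \<notin> path_image l" using segreal assms(1) by fastforce
  have vA: "valid_path A" and vB: "valid_path B" and vl: "valid_path l"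
    unfolding A_def B_def l_def by auto
  have ends: "pathstart A = of_real R" "pathfinish A = of_real (-R)"
     "pathstart B = of_real (-R)" "pathfinish B = of_real R"
     "pathstart l = of_real R" "pathfinish l = of_real (-R)"
    by (simp_all add: A_def B_def l_def exp_Euler)
  let ?k = "\<lambda>t. (1 / ((0 + of_real R * cis t) - w)) * R * \<i> * cis t"
  have ne: "of_real R * cis t - w \<noteq> 0" for t
    using R assms(2) by (metis abs_of_pos cmod_def eq_iff_diff_eq_0 less_irrefl mult.right_neutral norm_cis norm_mult norm_of_real)
  have "winding_number A w + winding_number B w = winding_number (circlepath 0 R) w"
  proof -
    have int: "?k integrable_on {0..2*pi}"
      using ne by (intro integrable_continuous_interval continuous_intros) auto
    have "integral {0..pi} ?k + integral {pi..2*pi} ?k = integral {0..2*pi} ?k"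
      by (rule Henstock_Kurzweil_Integration.integral_combine) (use int in auto)
    moreover have "w \<notin> path_image (circlepath 0 R)" "valid_path (circlepath 0 R)"
      using R assms(2) by auto
    ultimately show ?thesis
      using winding_number_valid_path[OF vA wA] winding_number_valid_path[OF vB wB]
        winding_number_valid_path[of "circlepath 0 R" w]
      by (simp add: A_def B_def circlepath_def contour_integral_part_circlepath_eq flip: add_divide_distrib)
  qed
  also have "\<dots> = 1" using assms(2) by (simp add: winding_number_circlepath)
  finally have full: "winding_number A w + winding_number B w = 1" .
  have "winding_number (B +++ l) w = 0"
  proof (rule winding_number_zero_outside)
    show "convex {x. Im x \<le> 0}" by (rule convex_halfspace_Im_le)
    show "path_image (B +++ l) \<subseteq> {x. Im x \<le> 0}"
      using lower segreal by (subst path_image_join) (auto simp: ends)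
    show "w \<notin> {x. Im x \<le> 0}" using assms by auto
  qed (use vB vl ends in \<open>auto intro!: path_join_imp simp: valid_path_imp_path\<close>)
  hence "winding_number B w + winding_number l w = 0"
    using vB vl wB wl ends by (subst (asm) winding_number_join) (auto simp: valid_path_imp_path)
  moreover have "winding_number (linepath (of_real (-R)) (of_real R)) w = - winding_number l w"
    using winding_number_reversepath[of l w] wl vl
    by (simp add: l_def valid_path_imp_path)
  moreover have "winding_number (A +++ linepath (of_real (-R)) (of_real R)) w
     = winding_number A w + winding_number (linepath (of_real (-R)) (of_real R)) w"
    using vA wA wl ends unfolding l_def
    by (subst winding_number_join) (auto simp: valid_path_imp_path closed_segment_commute)
  ultimately show ?thesis using full unfolding A_def by (simp add: add_eq_0_iff)
qed


lemma integrable_one_plus_abs_powr: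
  fixes \<gamma> :: real
  assumes "0 < \<gamma>"
  shows "integrable lborel (\<lambda>x::real. (1 + \<bar>x\<bar>) powr (- 1 - \<gamma>))"
proof -
  let ?f = "\<lambda>x::real. (1 + \<bar>x\<bar>) powr (- 1 - \<gamma>)"
  let ?F = "\<lambda>x::real. - ((1 + x) powr (- \<gamma>)) / \<gamma>"
  have "(\<integral>\<^sup>+x. ennreal (?f x) * indicator {0 ..} x \<partial>lborel) = 0 - ?F 0"
  proof (rule nn_integral_FTC_atLeast)
    fix x :: real assume x: "0 \<le> x"
    have "(?F has_real_derivative (1 + x) powr (- 1 - \<gamma>)) (at x)"
      using x assms by (auto intro!: derivative_eq_intros simp: minus_diff_commute)
    thus "DERIV ?F x :> ?f x" using x by simp
  next
    show "(?F \<longlongrightarrow> 0) at_top" using assms by real_asymp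
  qed (use assms in auto)
  hence nn: "integrable lborel (\<lambda>x. ?f x * indicator {0..} x)"
    by (intro integrableI_nonneg)
      (auto simp: ennreal_mult' ennreal_indicator split: split_indicator intro!: AE_I2)
  have "integrable lborel (\<lambda>x. ?f x * indicator {0..} x + ?f (- x) * indicator {0..} (- x))"
    using lborel_integrable_real_affine[OF nn, of "-1" 0] nn
    by (intro Bochner_Integration.integrable_add) auto
  thus ?thesis
    by (rule Bochner_Integration.integrable_bound) (auto split: split_indicator)
qed

text \<open>Cauchy's formula on the half-disc of radius \<open>R\<close>, in the version that only needs continuity up to the
boundary. On the arc the integrand is \<open>O(R\<^sup>-\<^sup>1\<^sup>-\<^sup>\<gamma>)\<close> and the length is \<open>\<pi>R\<close>, so the arc contributes
\<open>O(R\<^sup>-\<^sup>\<gamma>)\<close>.\<close>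

proposition Cauchy_formula_upper_half_plane:
  assumes "0 < \<gamma>"
    and cont: "continuous_on uhp_closed f" and hol: "f holomorphic_on uhp"
    and bound: "\<And>u. u \<in> uhp_closed \<Longrightarrow> cmod (f u) \<le> C * (1 + cmod u) powr - \<gamma>"
    and w: "w \<in> uhp"
  shows "integrable lborel (\<lambda>x. f (of_real x) / (of_real x - w))" (is "integrable _ ?h")
    and "(LINT x|lborel. f (of_real x) / (of_real x - w)) = 2 * pi * \<i> * f w"
proof -
  have Imw: "0 < Im w" using w by (simp add: uhp_def)
  have C: "0 \<le> C" using bound[of 0] norm_ge_zero[of "f 0"] by (auto simp: uhp_closed_def simp del: norm_ge_zero)
  have real_mem: "of_real x \<in> uhp_closed" for x by (simp add: uhp_closed_def)
  have ne: "of_real x - w \<noteq> 0" for x using Imw by (auto simp: complex_eq_iff)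
  have cont_real: "continuous_on A (\<lambda>x. f (of_real x))" for A
    by (rule continuous_on_compose2[OF cont]) (auto intro!: continuous_intros real_mem)
  have cont_h: "continuous_on A ?h" for A
    using ne by (intro continuous_intros cont_real) auto
  \<comment> \<open>Since \<open>\<bar>x - w\<bar> \<ge> Im w\<close>, this constant makes \<open>1 + \<bar>x\<bar> \<le> K \<bar>x - w\<bar>\<close>.\<close>
  define K where "K = 1 + (1 + cmod w) / Im w"
  have hbound: "cmod (?h x) \<le> C * K * (1 + \<bar>x\<bar>) powr (- 1 - \<gamma>)" for x
  proof -
    have d: "cmod (of_real x - w) > 0" using ne[of x] by simp
    have "1 + \<bar>x\<bar> \<le> (1 + cmod w) * 1 + cmod (of_real x - w)"
      using norm_triangle_sub[of "of_real x" w] by simp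
    also have "\<dots> \<le> (1 + cmod w) * (cmod (of_real x - w) / Im w) + cmod (of_real x - w)"
      using abs_Im_le_cmod[of "of_real x - w"] Imw by (intro add_right_mono mult_left_mono) auto
    also have "\<dots> = K * cmod (of_real x - w)" using Imw by (simp add: K_def field_simps)
    finally have *: "inverse (cmod (of_real x - w)) \<le> K * inverse (1 + \<bar>x\<bar>)"
      using d by (simp add: field_simps)
    have "cmod (?h x) = cmod (f (of_real x)) * inverse (cmod (of_real x - w))"
      by (simp add: norm_divide divide_inverse norm_mult norm_inverse)
    also have "\<dots> \<le> (C * (1 + \<bar>x\<bar>) powr - \<gamma>) * (K * inverse (1 + \<bar>x\<bar>))"
      using bound[OF real_mem, of x] * C by (intro mult_mono) auto
    also have "\<dots> = C * K * (1 + \<bar>x\<bar>) powr (- 1 - \<gamma>)"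
      by (simp add: powr_diff powr_minus divide_inverse)
    finally show ?thesis .
  qed
  show int: "integrable lborel ?h"
    by (rule Bochner_Integration.integrable_bound
        [OF integrable_mult_right[OF integrable_one_plus_abs_powr[OF assms(1)], of "C * K"]])
      (use hbound borel_measurable_continuous_onI[OF cont_h] in \<open>auto intro!: AE_I2 order_trans[OF hbound]\<close>)
  have segment: "(LINT x:{-R..R}|lborel. ?h x) = contour_integral (linepath (of_real (-R)) (of_real R)) (\<lambda>u. f u / (u - w))"
    if "R > 0" for R
  proof -
    have "set_integrable lborel {-R..R} ?h"
      unfolding set_integrable_def using int by (intro integrable_mult_indicator) auto
    thus ?thesis using that
      by (simp add: set_borel_integral_eq_integral contour_integral_linepath_Reals_eq)
  qed
  have estimate: "cmod ((LINT x:{-R..R}|lborel. ?h x) - 2 * pi * \<i> * f w) \<le> 2 * C * pi * (1 + R) powr - \<gamma>"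
    if R: "R > 2 * cmod w" for R
  proof -
    have R0: "R > 0" "R > cmod w" using R norm_ge_zero[of w] by linarith+
    define A where "A = part_circlepath 0 R 0 pi"
    define l where "l = linepath (of_real (-R)) (of_real R :: complex)"
    have A_mem: "u \<in> uhp_closed \<and> cmod u = R" if "u \<in> path_image A" for u
    proof -
      from that obtain t where "u = of_real R * exp (\<i> * of_real t)" "0 \<le> t" "t \<le> pi"
        unfolding A_def by (subst (asm) path_image_part_circlepath) auto
      thus ?thesis using R0 sin_ge_zero[of t] by (simp add: uhp_closed_def norm_mult Im_exp)
    qed
    have l_mem: "Im u = 0" if "u \<in> path_image l" for u
      using that by (auto simp: l_def in_segment)
    have ends: "pathfinish A = pathstart l" "pathfinish l = pathstart A"
      by (simp_all add: A_def l_def exp_Euler)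
    have valid: "valid_path A" "valid_path l" by (simp_all add: A_def l_def)
    have img: "path_image (A +++ l) \<subseteq> uhp_closed - {w}"
      using A_mem l_mem R0 Imw by (subst path_image_join) (auto simp: ends uhp_closed_def)
    have int_uhp: "interior uhp_closed = uhp"
      using interior_halfspace_ge[of \<i> 0] by (simp add: uhp_closed_def uhp_def inner_complex_def)
    have "((\<lambda>u. f u / (u - w)) has_contour_integral
        (2 * pi * \<i> * winding_number (A +++ l) w * f w)) (A +++ l)"
    proof (rule Cauchy_integral_formula_weak[where S = uhp_closed and k = "{}"])
      show "convex uhp_closed" unfolding uhp_closed_def by (rule convex_halfspace_Im_ge)
      show "x \<in> interior uhp_closed - {} \<Longrightarrow> f field_differentiable at x" for x
        using hol int_uhp by (metis Diff_empty open_interior holomorphic_on_imp_differentiable_at)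
    qed (use cont w img valid ends int_uhp in auto)
    hence "((\<lambda>u. f u / (u - w)) has_contour_integral (2 * pi * \<i> * f w)) (A +++ l)"
      using winding_number_upper_semicircle[OF Imw R0(2)] by (simp add: A_def l_def)
    moreover from this have ints: "(\<lambda>u. f u / (u - w)) contour_integrable_on A"
       "(\<lambda>u. f u / (u - w)) contour_integrable_on l"
      using valid ends contour_integrable_join[of A l] contour_integrable_on_def by blast+
    ultimately have "2 * pi * \<i> * f w = contour_integral A (\<lambda>u. f u / (u - w)) + contour_integral l (\<lambda>u. f u / (u - w))"
      using valid contour_integral_join contour_integral_unique by metis
    hence "cmod ((LINT x:{-R..R}|lborel. ?h x) - 2 * pi * \<i> * f w) = cmod (contour_integral A (\<lambda>u. f u / (u - w)))"
      using segment[OF R0(1)] by (simp add: l_def norm_minus_commute)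
    also have "\<dots> \<le> (C * (1 + R) powr - \<gamma> * (2 / R)) * R * \<bar>pi - 0\<bar>"
      unfolding A_def
    proof (rule contour_integral_bound_part_circlepath)
      fix u assume "u \<in> path_image (part_circlepath 0 R 0 pi)"
      hence u: "u \<in> uhp_closed" "cmod u = R" using A_mem by (auto simp: A_def)
      have "cmod (u - w) \<ge> R / 2" using u R norm_triangle_ineq2[of u w] by simp
      hence "inverse (cmod (u - w)) \<le> 2 / R"
        using R0 le_imp_inverse_le[of "R/2" "cmod (u - w)"] by simp
      thus "cmod (f u / (u - w)) \<le> C * (1 + R) powr - \<gamma> * (2 / R)"
        unfolding norm_divide divide_inverse[of "cmod (f u)"]
        using bound[OF u(1)] u C by (intro mult_mono) auto
    qed (use ints R0 C in \<open>auto simp: A_def\<close>)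
    also have "\<dots> = 2 * C * pi * (1 + R) powr - \<gamma>" using R0 by simp
    finally show ?thesis .
  qed
  have lim0: "((\<lambda>n. (LINT x:{- real n..real n}|lborel. ?h x) - 2 * pi * \<i> * f w) \<longlongrightarrow> 0) sequentially"
  proof (rule Lim_null_comparison)
    show "\<forall>\<^sub>F n in sequentially. cmod ((LINT x:{- real n..real n}|lborel. ?h x) - 2 * pi * \<i> * f w)
        \<le> 2 * C * pi * (1 + real n) powr - \<gamma>"
      using filterlim_at_top_dense[THEN iffD1, OF filterlim_real_sequentially, rule_format, of "2 * cmod w"]
      by eventually_elim (rule estimate)
    show "(\<lambda>n. 2 * C * pi * (1 + real n) powr - \<gamma>) \<longlonglongrightarrow> 0" using assms(1) by real_asymp
  qed
  have lim1: "(\<lambda>n. LINT x:{- real n..real n}|lborel. ?h x) \<longlonglongrightarrow> (LINT x|lborel. ?h x)"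
    unfolding set_lebesgue_integral_def
  proof (rule integral_dominated_convergence[where w = "\<lambda>x. cmod (?h x)"])
    show "AE x in lborel. (\<lambda>n. indicat_real {- real n..real n} x *\<^sub>R ?h x) \<longlonglongrightarrow> ?h x"
    proof (rule AE_I2, rule tendsto_eventually)
      fix x :: real
      show "\<forall>\<^sub>F n in sequentially. indicat_real {- real n..real n} x *\<^sub>R ?h x = ?h x"
        using filterlim_at_top[THEN iffD1, OF filterlim_real_sequentially, rule_format, of "\<bar>x\<bar>"]
        by eventually_elim (auto simp: abs_le_iff)
    qed
  qed (use int in \<open>auto split: split_indicator intro!: AE_I2 borel_measurable_continuous_onI[OF cont_h]\<close>)
  show "(LINT x|lborel. ?h x) = 2 * pi * \<i> * f w"
    using LIMSEQ_unique[OF lim1, of "2 * pi * \<i> * f w"] lim0 by (simp add: LIM_zero_iff)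
qed

text \<open>The product \<open>F\<close> of \<open>f\<close> with the Blaschke factor \<open>(u - w)/(u - cnj w)\<close> satisfies
\<open>F(u)/(u - w) = f(u)/(u - cnj w)\<close> and \<open>F(w) = 0\<close>. The factor has modulus at most one on the closed
half-plane, so Cauchy's formula applies to \<open>F\<close>.\<close>

proposition Cauchy_formula_upper_half_plane_outside:
  assumes "0 < \<gamma>"
    and cont: "continuous_on uhp_closed f" and hol: "f holomorphic_on uhp"
    and bound: "\<And>u. u \<in> uhp_closed \<Longrightarrow> cmod (f u) \<le> C * (1 + cmod u) powr - \<gamma>"
    and w: "w \<in> uhp"
  shows "integrable lborel (\<lambda>x. f (of_real x) / (of_real x - cnj w))"
    and "(LINT x|lborel. f (of_real x) / (of_real x - cnj w)) = 0"
proof -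
  define F where "F = (\<lambda>u. f u * ((u - w) / (u - cnj w)))"
  have ne: "u - cnj w \<noteq> 0" if "u \<in> uhp_closed" for u
    using that w by (auto simp: uhp_def uhp_closed_def complex_eq_iff)
  have ratio: "cmod ((u - w) / (u - cnj w)) \<le> 1" if "u \<in> uhp_closed" for u
  proof -
    have "\<bar>Im u - Im w\<bar> \<le> \<bar>Im u + Im w\<bar>" using that w by (auto simp: uhp_def uhp_closed_def)
    hence "cmod (u - w) \<le> cmod (u - cnj w)"
      unfolding cmod_def by (auto intro!: add_left_mono simp: abs_le_square_iff)
    thus ?thesis using ne[OF that] by (simp add: norm_divide)
  qed
  have F: "continuous_on uhp_closed F" "F holomorphic_on uhp"
    unfolding F_def using ne
    by (intro continuous_intros holomorphic_intros cont hol; force simp: uhp_def uhp_closed_def)+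
  have bF: "cmod (F u) \<le> C * (1 + cmod u) powr - \<gamma>" if "u \<in> uhp_closed" for u
    unfolding F_def norm_mult using mult_mono[OF bound[OF that] ratio[OF that]] bound[OF that]
    by (metis (no_types, lifting) mult.right_neutral norm_ge_zero order_trans)
  have eq: "F (of_real x) / (of_real x - w) = f (of_real x) / (of_real x - cnj w)" for x
  proof -
    have "of_real x - w \<noteq> 0" using w by (auto simp: uhp_def complex_eq_iff)
    thus ?thesis by (simp add: F_def)
  qed
  show "integrable lborel (\<lambda>x. f (of_real x) / (of_real x - cnj w))"
    using Cauchy_formula_upper_half_plane(1)[OF assms(1) F bF w] by (simp add: eq)
  show "(LINT x|lborel. f (of_real x) / (of_real x - cnj w)) = 0"
    using Cauchy_formula_upper_half_plane(2)[OF assms(1) F bF w] by (simp add: eq) (simp add: F_def)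
qed

section \<open>The conformal map onto the tilted cone\<close>

text \<open>The power map in the right half-plane, where it is symmetric about the real axis and the principal
logarithm is continuous up to the boundary except at \<open>0\<close>. After the rotation \<open>p = -\<i>u\<close> it replaces
the power with the cut along the negative imaginary axis.\<close>

definition sector_power :: "real \<Rightarrow> complex \<Rightarrow> complex" where
  "sector_power \<gamma> p = (if p = 0 then 0 else exp (of_real \<gamma> * Ln p))"

lemma pow_cut_eq_sector_power:
  "exp (\<i> * of_real (pi / 2 * (1 - \<gamma>))) * pow_cut u \<gamma> = \<i> * sector_power \<gamma> (- \<i> * u)"
proof (cases "u = 0")
  case False
  have "exp (\<i> * of_real (pi / 2 * (1 - \<gamma>))) * pow_cut u \<gamma>
      = exp (\<i> * of_real (pi / 2 * (1 - \<gamma>)) + of_real \<gamma> * log_cut u)"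
    using False by (simp add: pow_cut_def exp_add)
  also have "\<i> * of_real (pi / 2 * (1 - \<gamma>)) + of_real \<gamma> * log_cut u
      = \<i> * of_real (pi/2) + of_real \<gamma> * Ln (- \<i> * u)"
    by (simp add: log_cut_def algebra_simps add_divide_distrib diff_divide_distrib)
  also have "exp \<dots> = \<i> * sector_power \<gamma> (- \<i> * u)"
    using False exp_Euler[of "of_real (pi/2)"]
    by (simp add: exp_add sector_power_def cos_of_real sin_of_real)
  finally show ?thesis .
qed (simp add: pow_cut_def sector_power_def)

lemma norm_sector_power:
  assumes "0 < \<gamma>"
  shows "cmod (sector_power \<gamma> p) = cmod p powr \<gamma>"
  using assms by (auto simp: sector_power_def powr_def)

lemma sector_power_eq_rcis:
  assumes "p \<noteq> 0"
  shows "sector_power \<gamma> p = of_real (cmod p powr \<gamma>) * exp (\<i> * of_real (\<gamma> * Im (Ln p)))"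
proof -
  have "of_real \<gamma> * Ln p = of_real (\<gamma> * ln (cmod p)) + \<i> * of_real (\<gamma> * Im (Ln p))"
    using assms by (simp add: complex_eq_iff)
  thus ?thesis using assms by (simp add: sector_power_def powr_def exp_add flip: exp_of_real)
qed

text \<open>The argument of \<open>p\<^sup>\<gamma>\<close> is at most \<open>\<pi>\<gamma>/2\<close> in modulus, so a rotation by \<open>\<theta>\<close> leaves it within \<open>\<alpha>\<close> of
the positive real axis.\<close>

lemma Re_rotated_sector_power_ge:
  assumes "0 < \<gamma>" "0 \<le> Re p" "\<bar>\<theta>\<bar> + pi / 2 * \<gamma> \<le> \<alpha>" "\<alpha> \<le> pi"
  shows "Re (exp (\<i> * of_real \<theta>) * sector_power \<gamma> p) \<ge> cos \<alpha> * cmod p powr \<gamma>"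
proof (cases "p = 0")
  case False
  have a: "\<bar>Im (Ln p)\<bar> \<le> pi / 2"
    using Re_Ln_pos_le[OF False] assms by simp
  have "\<bar>\<theta> + \<gamma> * Im (Ln p)\<bar> \<le> \<bar>\<theta>\<bar> + \<gamma> * \<bar>Im (Ln p)\<bar>"
    using assms(1) abs_triangle_ineq[of \<theta> "\<gamma> * Im (Ln p)"] by (simp add: abs_mult)
  also have "\<dots> \<le> \<bar>\<theta>\<bar> + \<gamma> * (pi / 2)"
    using assms(1) a by (intro add_left_mono mult_left_mono) auto
  also have "\<dots> \<le> \<alpha>" using assms by (simp add: mult.commute)
  finally have "cos \<alpha> \<le> cos \<bar>\<theta> + \<gamma> * Im (Ln p)\<bar>"
    using assms by (intro cos_monotone_0_pi_le) auto
  moreover have "Re (exp (\<i> * of_real \<theta>) * sector_power \<gamma> p)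
       = cmod p powr \<gamma> * cos (\<theta> + \<gamma> * Im (Ln p))"
    unfolding sector_power_eq_rcis[OF False]
    by (simp only: cis_conv_exp[symmetric]) (simp add: cos_add algebra_simps)
  ultimately show ?thesis
    using mult_left_mono[of "cos \<alpha>" "cos (\<theta> + \<gamma> * Im (Ln p))" "cmod p powr \<gamma>"]
    by (simp add: mult.commute[of "cos \<alpha>"] del: times_complex.simps)
qed (simp add: sector_power_def)

lemma continuous_on_sector_power:
  assumes "0 < \<gamma>"
  shows "continuous_on {p. 0 \<le> Re p} (sector_power \<gamma>)"
proof (rule continuous_on_eq_continuous_within[THEN iffD2], rule ballI)
  fix p :: complex assume p: "p \<in> {p. 0 \<le> Re p}"
  show "continuous (at p within {p. 0 \<le> Re p}) (sector_power \<gamma>)"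
  proof (cases "p = 0")
    case True
    \<comment> \<open>The logarithm has no limit at \<open>0\<close>, but the modulus of the power tends to \<open>0\<close>.\<close>
    have "((\<lambda>q. cmod (sector_power \<gamma> q)) \<longlongrightarrow> 0) (at 0 within {p. 0 \<le> Re p})"
      unfolding norm_sector_power[OF assms]
      by (rule tendsto_eq_intros refl tendsto_powr' | use assms in auto)+
    hence "(sector_power \<gamma> \<longlongrightarrow> 0) (at 0 within {p. 0 \<le> Re p})"
      by (rule tendsto_norm_zero_cancel)
    thus ?thesis using True by (simp add: continuous_within sector_power_def)
  next
    case False
    have "p \<notin> \<real>\<^sub>\<le>\<^sub>0" using False p by (auto simp: complex_nonpos_Reals_iff complex_eq_iff)
    hence "isCont (\<lambda>q. exp (of_real \<gamma> * Ln q)) p"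
      by (intro continuous_intros) auto
    moreover have "\<forall>\<^sub>F q in nhds p. exp (of_real \<gamma> * Ln q) = sector_power \<gamma> q"
      using t1_space_nhds[OF False] by eventually_elim (simp add: sector_power_def)
    ultimately have "isCont (sector_power \<gamma>) p"
      using isCont_cong[of "\<lambda>q. exp (of_real \<gamma> * Ln q)" "sector_power \<gamma>" p] by blast
    thus ?thesis by (rule continuous_at_imp_continuous_at_within)
  qed
qed

lemma holomorphic_on_sector_power: "sector_power \<gamma> holomorphic_on {p. 0 < Re p}"
proof (rule holomorphic_transform)
  show "(\<lambda>p. exp (of_real \<gamma> * Ln p)) holomorphic_on {p. 0 < Re p}"
    by (intro holomorphic_intros) (auto simp: complex_nonpos_Reals_iff)
qed (auto simp: sector_power_def)

text \<open>In polar coordinates the cone condition compares \<open>cos (arg q)\<close> with \<open>cos \<alpha>\<close>. In logarithmic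
coordinates a sector is a horizontal strip.\<close>

lemma sector_iff_Ln:
  assumes "0 < \<alpha>" "\<alpha> \<le> pi/2"
  shows "Re q > cos \<alpha> * cmod q \<longleftrightarrow> q \<noteq> 0 \<and> \<bar>Im (Ln q)\<bar> < \<alpha>"
proof (cases "q = 0")
  case False
  have "q = of_real (cmod q) * cis (Im (Ln q))"
    using sector_power_eq_rcis[OF False, of 1] False by (simp add: sector_power_def cis_conv_exp)
  hence "Re q = cmod q * cos \<bar>Im (Ln q)\<bar>"
    by (metis Re_complex_of_real Im_complex_of_real cis.simps(1) cos_abs_real times_complex.simps(1) mult_zero_left diff_zero)
  moreover have "cos \<alpha> < cos \<bar>Im (Ln q)\<bar> \<longleftrightarrow> \<bar>Im (Ln q)\<bar> < \<alpha>"
    using assms Im_Ln_le_pi[OF False] mpi_less_Im_Ln[OF False] by (intro cos_mono_less_eq) auto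
  ultimately show ?thesis using False by (simp add: mult.commute)
qed simp

text \<open>In logarithmic coordinates the power map is multiplication by \<open>\<gamma>\<close>, which carries the strip of
half-width \<open>\<pi>/2\<close> onto the one of half-width \<open>\<pi>\<gamma>/2\<close>; both are narrow enough for the exponential to be
inverted by the principal logarithm.\<close>

lemma bij_betw_sector_power:
  assumes "0 < \<gamma>" "\<gamma> \<le> 1"
  shows "bij_betw (sector_power \<gamma>) {p. 0 < Re p} {q. Re q > cos (pi / 2 * \<gamma>) * cmod q}"
proof (rule bij_betw_byWitness[where f' = "\<lambda>q. exp (Ln q / of_real \<gamma>)"])
  define \<alpha> where "\<alpha> = pi / 2 * \<gamma>"
  have g: "0 < \<alpha>" "\<alpha> \<le> pi / 2" using assms by (auto simp: \<alpha>_def)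
  have half: "0 < Re p \<longleftrightarrow> p \<noteq> 0 \<and> \<bar>Im (Ln p)\<bar> < pi/2" for p
    using sector_iff_Ln[of "pi/2" p] by simp
  have Ln_pow: "Ln (sector_power \<gamma> p) = of_real \<gamma> * Ln p" "\<bar>Im (of_real \<gamma> * Ln p)\<bar> < \<alpha>"
      "sector_power \<gamma> p \<noteq> 0" if "0 < Re p" for p
  proof -
    have p: "p \<noteq> 0" "\<bar>Im (Ln p)\<bar> < pi/2" using that half by auto
    show *: "\<bar>Im (of_real \<gamma> * Ln p)\<bar> < \<alpha>"
      using p assms by (simp add: abs_mult \<alpha>_def)
    have "Ln (exp (of_real \<gamma> * Ln p)) = of_real \<gamma> * Ln p"
      using * g pi_gt_zero by (intro Ln_exp) linarith+
    thus "Ln (sector_power \<gamma> p) = of_real \<gamma> * Ln p" "sector_power \<gamma> p \<noteq> 0"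
      using p by (simp_all add: sector_power_def)
  qed
  show "\<forall>p\<in>{p. 0 < Re p}. exp (Ln (sector_power \<gamma> p) / of_real \<gamma>) = p"
    using Ln_pow assms by (auto simp: half)
  have Ln_root: "Ln (exp (Ln q / of_real \<gamma>)) = Ln q / of_real \<gamma>" "\<bar>Im (Ln q / of_real \<gamma>)\<bar> < pi/2"
    if "\<bar>Im (Ln q)\<bar> < \<alpha>" for q
  proof -
    show *: "\<bar>Im (Ln q / of_real \<gamma>)\<bar> < pi/2"
      using that assms by (simp add: divide_simps \<alpha>_def)
    show "Ln (exp (Ln q / of_real \<gamma>)) = Ln q / of_real \<gamma>"
      using * pi_gt_zero by (intro Ln_exp) linarith+
  qed
  show "\<forall>q\<in>{q. Re q > cos (pi / 2 * \<gamma>) * cmod q}. sector_power \<gamma> (exp (Ln q / of_real \<gamma>)) = q"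
    using Ln_root(1) assms unfolding \<alpha>_def[symmetric]
    by (auto simp: sector_iff_Ln[OF g] sector_power_def)
  show "sector_power \<gamma> ` {p. 0 < Re p} \<subseteq> {q. Re q > cos (pi / 2 * \<gamma>) * cmod q}"
    using Ln_pow unfolding \<alpha>_def[symmetric]
    by (auto simp: sector_iff_Ln[OF g] simp del: times_complex.simps)
  show "(\<lambda>q. exp (Ln q / of_real \<gamma>)) ` {q. Re q > cos (pi / 2 * \<gamma>) * cmod q} \<subseteq> {p. 0 < Re p}"
    using Ln_root unfolding \<alpha>_def[symmetric]
    by (auto simp only: sector_iff_Ln[OF g] half mem_Collect_eq image_subset_iff exp_not_eq_zero)
qed

text \<open>A boundary point is not interior: moving left by \<open>e\<close> lowers the real part by \<open>e\<close>, but the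
right-hand side only by at most \<open>k e < e\<close>.\<close>

lemma interior_sector:
  assumes "0 \<le> k" "k < 1"
  shows "interior {q :: complex. Re q \<ge> k * cmod q} = {q. Re q > k * cmod q}"
proof (rule interior_unique)
  show "open {q. Re q > k * cmod q}"
    by (intro open_Collect_less continuous_intros)
  fix T assume T: "T \<subseteq> {q :: complex. Re q \<ge> k * cmod q}" "open T"
  show "T \<subseteq> {q. Re q > k * cmod q}"
  proof
    fix q assume q: "q \<in> T"
    then obtain e where e: "e > 0" "cball q e \<subseteq> T" using T open_contains_cball by blast
    hence "q - of_real e \<in> T" by (auto simp: dist_norm)
    hence "Re q - e \<ge> k * cmod (q - of_real e)" using T by auto
    moreover have "cmod (q - of_real e) \<ge> cmod q - e"
      using norm_triangle_ineq2[of q "of_real e"] e by simp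
    ultimately have "Re q - e \<ge> k * (cmod q - e)"
      using assms mult_left_mono by (meson order_trans)
    moreover have "k * e < e" using e assms by simp
    ultimately show "q \<in> {q. Re q > k * cmod q}" by (simp add: algebra_simps)
  qed
qed auto

text \<open>The rigid motion that carries the cone around the positive real axis with vertex \<open>0\<close> to the cone
with vertex \<open>z\<close> around the upward vertical tilted by \<open>\<theta>\<close>.\<close>

definition cone_map :: "complex \<Rightarrow> real \<Rightarrow> complex \<Rightarrow> complex" where
  "cone_map z \<theta> q = z + exp (\<i> * of_real \<theta>) * \<i> * q"

lemma psi_eq_cone_map:
  "psi \<gamma> \<omega> z \<xi> u = cone_map z (\<omega> z) (sector_power \<gamma> (- \<i> * u) - of_real \<xi>)"
  unfolding psi_def pow_cut_eq_sector_power by (simp add: cone_map_def algebra_simps)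

text \<open>The number \<open>\<i> \<xi>\<^sup>1\<^sup>/\<^sup>\<gamma>\<close> rotates to the positive real axis, where the power map is the real one; its value
\<open>\<xi>\<close> cancels the shift of the vertex.\<close>

lemma psi_vertex_preimage:
  assumes "0 < \<gamma>" "0 < \<xi>"
  shows "psi \<gamma> \<omega> z \<xi> (\<i> * of_real (\<xi> powr (1 / \<gamma>))) = z"
proof -
  have "sector_power \<gamma> (of_real (\<xi> powr (1 / \<gamma>))) = of_real \<xi>"
    using assms by (simp add: sector_power_eq_rcis powr_powr)
  thus ?thesis by (simp add: psi_eq_cone_map cone_map_def)
qed

text \<open>The cone deviates from the vertical by at most \<open>\<bar>\<omega>(z)\<bar> + \<pi>\<gamma>/2 \<le> \<pi>\<gamma> \<le> \<pi>/4\<close>, and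
\<open>cos (\<pi>/4) \<ge> 1/2\<close>; shifting the vertex costs at most \<open>\<xi>\<close>.\<close>

lemma Im_psi_ge:
  assumes \<gamma>: "0 < \<gamma>" "\<gamma> \<le> 1 / 4" and \<omega>: "\<bar>\<omega> z\<bar> \<le> pi / 2 * \<gamma>" and \<xi>: "0 < \<xi>"
    and u: "u \<in> uhp_closed"
  shows "Im z - \<xi> + cmod u powr \<gamma> / 2 \<le> Im (psi \<gamma> \<omega> z \<xi> u)"
proof -
  let ?q = "sector_power \<gamma> (- \<i> * u)"
  have "cos (pi / 4) * cmod (- \<i> * u) powr \<gamma> \<le> Re (exp (\<i> * of_real (\<omega> z)) * ?q)"
  proof (rule Re_rotated_sector_power_ge)
    have "pi * \<gamma> \<le> pi * (1 / 4)" using \<gamma> by (intro mult_left_mono) auto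
    thus "\<bar>\<omega> z\<bar> + pi / 2 * \<gamma> \<le> pi / 4" using \<omega> by linarith
  qed (use \<gamma> u in \<open>auto simp: uhp_closed_def\<close>)
  moreover have "1 / 2 \<le> cos (pi / 4)"
    using cos_monotone_0_pi_le[of "pi/4" "pi/3"] by (simp add: cos_60)
  ultimately have "cmod u powr \<gamma> / 2 \<le> Re (exp (\<i> * of_real (\<omega> z)) * ?q)"
    using mult_right_mono[of "1/2" "cos (pi/4)" "cmod u powr \<gamma>"] by (simp add: norm_mult)
  moreover have "Re (exp (\<i> * of_real (\<omega> z)) * of_real \<xi>) \<le> \<xi>"
    using \<xi> by (simp flip: cis_conv_exp)
  moreover have "Im (psi \<gamma> \<omega> z \<xi> u) = Im z + Re (exp (\<i> * of_real (\<omega> z)) * ?q) - Re (exp (\<i> * of_real (\<omega> z)) * of_real \<xi>)"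
    by (simp add: psi_eq_cone_map cone_map_def algebra_simps)
  ultimately show ?thesis by linarith
qed

lemma psi_uhp:
  assumes "0 < \<gamma>" "\<gamma> \<le> 1 / 4" "\<bar>\<omega> z\<bar> \<le> pi / 2 * \<gamma>" "0 < \<xi>" "\<xi> < Im z" "u \<in> uhp_closed"
  shows "psi \<gamma> \<omega> z \<xi> u \<in> uhp"
proof -
  have "0 \<le> cmod u powr \<gamma> / 2" by simp
  moreover have "Im z - \<xi> + cmod u powr \<gamma> / 2 \<le> Im (psi \<gamma> \<omega> z \<xi> u)"
    using assms by (intro Im_psi_ge)
  ultimately show ?thesis using assms(5) unfolding uhp_def mem_Collect_eq by linarith
qed

lemma continuous_on_psi:
  assumes "0 < \<gamma>"
  shows "continuous_on uhp_closed (psi \<gamma> \<omega> z \<xi>)"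
  unfolding psi_eq_cone_map cone_map_def
  by (intro continuous_intros continuous_on_compose2[OF continuous_on_sector_power[OF assms]])
     (auto simp: uhp_closed_def)

lemma holomorphic_on_psi: "psi \<gamma> \<omega> z \<xi> holomorphic_on uhp"
proof -
  have "(sector_power \<gamma> \<circ> (\<lambda>u. - \<i> * u)) holomorphic_on uhp"
    by (rule holomorphic_on_compose_gen[OF _ holomorphic_on_sector_power])
       (auto intro!: holomorphic_intros simp: uhp_def)
  thus ?thesis unfolding psi_eq_cone_map cone_map_def o_def by (intro holomorphic_intros)
qed

lemma tilted_cone_eq_image:
  assumes "0 < Im z"
  shows "tilted_cone \<gamma> \<theta> z = cone_map z \<theta> ` {q. Re q \<ge> cos (pi / 2 * \<gamma>) * cmod q}"
proof -
  let ?e = "exp (\<i> * of_real \<theta>)"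
  have in_cone: "cone_map z \<theta> q \<in> tilted_cone \<gamma> \<theta> z \<longleftrightarrow> Re q \<ge> cos (pi / 2 * \<gamma>) * cmod q" for q
  proof -
    have "exp (- (\<i> * of_real \<theta>)) * (cone_map z \<theta> q - z) = \<i> * q"
      by (simp add: cone_map_def exp_minus)
    moreover have "cmod (cone_map z \<theta> q - z) = cmod q"
      by (simp add: cone_map_def norm_mult)
    ultimately show ?thesis using assms by (simp add: tilted_cone_def del: times_complex.sel)
  qed
  have "\<zeta> = cone_map z \<theta> ((\<zeta> - z) / (?e * \<i>))" for \<zeta> by (simp add: cone_map_def)
  thus ?thesis using in_cone by (auto simp: image_iff) metis+
qed

text \<open>The shifted cone is an injective affine image of the standard sector, and such maps commute with
taking the interior.\<close>

lemma interior_shifted_cone: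
  assumes "0 < \<gamma>" "\<gamma> \<le> 1" "0 < Im z"
  shows "interior ({- \<i> * exp (\<i> * of_real \<theta>) * of_real \<xi>} + tilted_cone \<gamma> \<theta> z)
    = (\<lambda>q. cone_map z \<theta> (q - of_real \<xi>)) ` {q. Re q > cos (pi / 2 * \<gamma>) * cmod q}"
proof -
  let ?d = "exp (\<i> * of_real \<theta>) * \<i>" and ?K = "{q. Re q \<ge> cos (pi / 2 * \<gamma>) * cmod q}"
  let ?c = "z - ?d * of_real \<xi>"
  have map: "(\<lambda>q. cone_map z \<theta> (q - of_real \<xi>)) ` A = (+) ?c ` ((*) ?d ` A)" for A
    by (simp add: image_image cone_map_def algebra_simps)
  have k: "0 \<le> cos (pi / 2 * \<gamma>)" "cos (pi / 2 * \<gamma>) < 1"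
  proof -
    have g: "0 < pi / 2 * \<gamma>" "pi / 2 * \<gamma> \<le> pi / 2" using assms by auto
    thus "0 \<le> cos (pi / 2 * \<gamma>)" using pi_gt_zero by (intro cos_ge_zero) linarith+
    show "cos (pi / 2 * \<gamma>) < 1" using cos_monotone_0_pi[of 0 "pi / 2 * \<gamma>"] g pi_gt_zero by simp
  qed
  have "{- \<i> * exp (\<i> * of_real \<theta>) * of_real \<xi>} + tilted_cone \<gamma> \<theta> z = (\<lambda>q. cone_map z \<theta> (q - of_real \<xi>)) ` ?K"
    unfolding tilted_cone_eq_image[OF assms(3)] set_plus_def
    by (auto simp: cone_map_def algebra_simps image_iff)
  hence "interior ({- \<i> * exp (\<i> * of_real \<theta>) * of_real \<xi>} + tilted_cone \<gamma> \<theta> z) = (+) ?c ` interior ((*) ?d ` ?K)"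
    by (simp add: map interior_translation)
  also have "interior ((*) ?d ` ?K) = (*) ?d ` interior ?K"
    by (rule interior_injective_linear_image) (auto simp: inj_on_def intro!: linear_times)
  finally show ?thesis by (simp only: interior_sector[OF k] map)
qed

lemma bij_betw_psi:
  assumes "0 < \<gamma>" "\<gamma> \<le> 1" "0 < Im z"
  shows "bij_betw (psi \<gamma> \<omega> z \<xi>) uhp
    (interior ({- \<i> * exp (\<i> * of_real (\<omega> z)) * of_real \<xi>} + tilted_cone \<gamma> (\<omega> z) z))"
proof -
  let ?c = "\<lambda>q. cone_map z (\<omega> z) (q - of_real \<xi>)"
  have "bij_betw (\<lambda>u. - \<i> * u) uhp {p. 0 < Re p}"
    by (rule bij_betw_byWitness[where f' = "\<lambda>p. \<i> * p"]) (auto simp: uhp_def)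
  moreover have "bij_betw ?c {q. Re q > cos (pi / 2 * \<gamma>) * cmod q} (?c ` {q. Re q > cos (pi / 2 * \<gamma>) * cmod q})"
    by (intro bij_betw_imageI) (auto simp: inj_on_def cone_map_def)
  ultimately have "bij_betw (?c \<circ> (sector_power \<gamma> \<circ> (\<lambda>u. - \<i> * u))) uhp (?c ` {q. Re q > cos (pi / 2 * \<gamma>) * cmod q})"
    using bij_betw_sector_power[OF assms(1,2)] by (blast intro: bij_betw_trans)
  thus ?thesis
    unfolding interior_shifted_cone[OF assms] by (simp add: o_def psi_eq_cone_map[abs_def])
qed

lemma inv_into_psi:
  assumes "0 < \<gamma>" "\<gamma> \<le> 1" "0 < Im z" "0 < \<xi>"
  shows "inv_into uhp (psi \<gamma> \<omega> z \<xi>) z = \<i> * of_real (\<xi> powr (1 / \<gamma>))"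
  using bij_betw_psi[OF assms(1-3), of \<omega> \<xi>] assms
  by (intro inv_into_f_eq psi_vertex_preimage) (auto simp: uhp_def bij_betw_def)

section \<open>The integral representation\<close>

lemma op_norm_bound: "norm (A *v v) \<le> op_norm A * norm v" for A :: "complex^'n^'n"
  unfolding op_norm_def by (intro onorm matrix_vector_mul_bounded_linear)

lemma norm_axis_one: "norm (axis j 1 :: complex^'n) = 1"
  by (simp add: norm_vec_def L2_set_def axis_def if_distrib[of norm] if_distrib[of "\<lambda>x. x\<^sup>2"] cong: if_cong)

lemma cmod_entry_le_op_norm: "cmod (A $ i $ j) \<le> op_norm A" for A :: "complex^'n^'n"
proof -
  have "cmod (A $ i $ j) = cmod ((A *v axis j 1) $ i)"
    by (simp add: matrix_vector_mult_def axis_def if_distrib[of "\<lambda>x. _ * x"] cong: if_cong)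
  also have "\<dots> \<le> norm (A *v axis j 1)" by (rule Finite_Cartesian_Product.norm_nth_le)
  also have "\<dots> \<le> op_norm A" using op_norm_bound[of A "axis j 1"] by (simp add: norm_axis_one)
  finally show ?thesis .
qed

text \<open>For \<open>\<bar>u\<bar> > R\<close> the point \<open>\<psi>(u)\<close> is above the threshold \<open>\<eta>\<close>, and \<open>Im \<psi>(u)\<close> is comparable to
\<open>(1 + \<bar>u\<bar>)\<^sup>\<gamma>\<close>. The remaining \<open>u\<close> form a compact set, on which \<open>f \<circ> \<psi>\<close> is bounded because \<open>\<psi>\<close> maps it
into the open half-plane.\<close>

lemma decay_along_psi:
  assumes \<gamma>: "0 < \<gamma>" "\<gamma> \<le> 1 / 4" and \<omega>: "\<bar>\<omega> z\<bar> \<le> pi / 2 * \<gamma>" and \<xi>: "0 < \<xi>" "\<xi> < Im z"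
    and cont: "continuous_on uhp f"
    and decay: "\<And>\<zeta>. 0 < Im \<zeta> \<Longrightarrow> \<eta> \<le> Im \<zeta> \<Longrightarrow> cmod (f \<zeta>) \<le> C / Im \<zeta>"
  obtains B where "\<And>u. u \<in> uhp_closed \<Longrightarrow> cmod (f (psi \<gamma> \<omega> z \<xi> u)) \<le> B * (1 + cmod u) powr - \<gamma>"
proof -
  let ?\<psi> = "psi \<gamma> \<omega> z \<xi>"
  \<comment> \<open>Beyond this radius \<open>\<bar>u\<bar>\<^sup>\<gamma>/2\<close> is at least \<open>\<eta>\<close>, and \<open>1 + \<bar>u\<bar> \<le> 2 \<bar>u\<bar>\<close>.\<close>
  define R where "R = max 1 ((2 * max \<eta> 0) powr (1 / \<gamma>))"
  have psi: "?\<psi> u \<in> uhp" if "u \<in> uhp_closed" for u using psi_uhp[where \<omega> = \<omega> and z = z, OF \<gamma> \<omega> \<xi> that] .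
  have "closed uhp_closed" unfolding uhp_closed_def by (rule closed_halfspace_Im_ge)
  hence "compact (uhp_closed \<inter> cball 0 R)" by (intro closed_Int_compact compact_cball)
  moreover have "continuous_on (uhp_closed \<inter> cball 0 R) (\<lambda>u. f (?\<psi> u))"
    by (rule continuous_on_subset[OF continuous_on_compose2[OF cont continuous_on_psi[OF \<gamma>(1)]]])
       (use psi in auto)
  ultimately have "bounded ((\<lambda>u. f (?\<psi> u)) ` (uhp_closed \<inter> cball 0 R))"
    by (intro compact_imp_bounded compact_continuous_image)
  then obtain b where b: "0 < b" "\<And>u. u \<in> uhp_closed \<Longrightarrow> cmod u \<le> R \<Longrightarrow> cmod (f (?\<psi> u)) \<le> b"
    unfolding bounded_pos by auto
  define B where "B = b * (1 + R) powr \<gamma> + 4 * max C 0"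
  have "cmod (f (?\<psi> u)) \<le> B * (1 + cmod u) powr - \<gamma>" if u: "u \<in> uhp_closed" for u
  proof -
    define P where "P = (1 + cmod u) powr \<gamma>"
    have P: "0 < P" "(1 + cmod u) powr - \<gamma> = 1 / P"
      using add_pos_nonneg[of 1 "cmod u"] by (auto simp: P_def powr_minus divide_inverse)
    have "cmod (f (?\<psi> u)) * P \<le> B"
    proof (cases "cmod u \<le> R")
      case True
      have "cmod (f (?\<psi> u)) * P \<le> b * (1 + R) powr \<gamma>"
        unfolding P_def using b u True \<gamma> by (intro mult_mono powr_mono2) auto
      thus ?thesis by (simp add: B_def)
    next
      case False
      hence "1 \<le> cmod u" by (simp add: R_def)
      have "P \<le> (2 * cmod u) powr \<gamma>"
        unfolding P_def using \<open>1 \<le> cmod u\<close> \<gamma> by (intro powr_mono2) auto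
      also have "\<dots> = 2 powr \<gamma> * cmod u powr \<gamma>" by (simp add: powr_mult)
      also have "\<dots> \<le> 2 * cmod u powr \<gamma>"
        using powr_mono[of \<gamma> 1 2] \<gamma> by (intro mult_right_mono) auto
      finally have P_le: "P \<le> 4 * Im (?\<psi> u)"
        using Im_psi_ge[where \<omega> = \<omega> and z = z, OF \<gamma> \<omega> \<xi>(1) u] \<xi> by linarith
      have "2 * max \<eta> 0 = ((2 * max \<eta> 0) powr (1 / \<gamma>)) powr \<gamma>" using \<gamma> by (simp add: powr_powr)
      also have "\<dots> \<le> cmod u powr \<gamma>"
        using False \<gamma> by (intro powr_mono2) (auto simp: R_def)
      finally have "\<eta> \<le> Im (?\<psi> u)" using Im_psi_ge[where \<omega> = \<omega> and z = z, OF \<gamma> \<omega> \<xi>(1) u] \<xi> by linarith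
      moreover have pos: "0 < Im (?\<psi> u)" using psi[OF u] by (simp add: uhp_def)
      ultimately have "cmod (f (?\<psi> u)) \<le> max C 0 / Im (?\<psi> u)"
        using decay[of "?\<psi> u"] divide_right_mono[of C "max C 0" "Im (?\<psi> u)"] by linarith
      hence "cmod (f (?\<psi> u)) * P \<le> max C 0 / Im (?\<psi> u) * (4 * Im (?\<psi> u))"
        using P_le P pos by (intro mult_mono) auto
      also have "\<dots> = 4 * max C 0" using pos by simp
      also have "\<dots> \<le> B" using b(1) by (simp add: B_def)
      finally show ?thesis .
    qed
    thus ?thesis unfolding P(2) using P(1) by (simp add: field_simps)
  qed
  thus thesis by (rule that)
qed

text \<open>A matrix is the sum of its entries placed in the corresponding positions, and each placement is a
bounded linear map.\<close>

lemma bochner_integral_matrix: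
  fixes F :: "'a \<Rightarrow> complex^'n^'m"
  assumes int: "\<And>i j. integrable M (\<lambda>x. F x $ i $ j)"
  shows "integrable M F" and "(LINT x|M. F x) $ i $ j = (LINT x|M. F x $ i $ j)"
proof -
  define E where "E = (\<lambda>i j c. (\<chi> k l. if k = i \<and> l = j then c else 0) :: complex^'n^'m)"
  have E: "bounded_linear (E i j)" for i j
    by (rule linear_conv_bounded_linear[THEN iffD1], rule linearI) (auto simp: E_def vec_eq_iff)
  have F: "F x = (\<Sum>i\<in>UNIV. \<Sum>j\<in>UNIV. E i j (F x $ i $ j))" for x
  proof -
    have "(\<Sum>i\<in>UNIV. \<Sum>j\<in>UNIV. E i j (F x $ i $ j)) $ k $ l = F x $ k $ l" for k l
    proof -
      have "(\<Sum>i\<in>UNIV. \<Sum>j\<in>UNIV. E i j (F x $ i $ j)) $ k $ l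
        = (\<Sum>i\<in>UNIV. if k = i then (\<Sum>j\<in>UNIV. if l = j then F x $ i $ j else 0) else 0)"
        unfolding sum_component E_def by (intro sum.cong refl) auto
      thus ?thesis by simp
    qed
    thus ?thesis by (simp add: vec_eq_iff)
  qed
  show *: "integrable M F"
    by (subst F[abs_def]) (intro Bochner_Integration.integrable_sum integrable_bounded_linear[OF E] int)
  show "(LINT x|M. F x) $ i $ j = (LINT x|M. F x $ i $ j)"
    using integral_bounded_linear[OF bounded_linear_compose[OF bounded_linear_vec_nth[of j] bounded_linear_vec_nth[of i]] *]
    by simp
qed

text \<open>The entry \<open>(i,j)\<close> of \<open>Im g\<close> involves \<open>g\<^sub>i\<^sub>j\<close> and the conjugate of \<open>g\<^sub>j\<^sub>i\<close>. The first contributes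
\<open>2\<pi>\<i> g\<^sub>i\<^sub>j(z)\<close> by Cauchy's formula at \<open>w = \<psi>\<^sup>-\<^sup>1(z)\<close>; the second is the conjugate of an integral with
pole at \<open>cnj w\<close> and vanishes.\<close>

proposition cone_integral_representation:
  fixes g :: "complex \<Rightarrow> complex^'n^'n"
  assumes \<gamma>: "0 < \<gamma>" "\<gamma> \<le> 1 / 4" and \<omega>: "\<bar>\<omega> z\<bar> \<le> pi / 2 * \<gamma>" and \<xi>: "0 < \<xi>" "\<xi> < Im z"
    and g: "analytic_mat g uhp"
    and decay: "\<And>\<zeta>. 0 < Im \<zeta> \<Longrightarrow> \<eta> \<le> Im \<zeta> \<Longrightarrow> op_norm (g \<zeta>) \<le> C / Im \<zeta>"
  defines "F \<equiv> \<lambda>x. cscale (1 / (of_real x - \<i> * of_real (\<xi> powr (1 / \<gamma>)))) (Im_mat (g (psi \<gamma> \<omega> z \<xi> (of_real x))))"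
  shows "integrable lborel F" and "g z = (1 / pi) *\<^sub>R (LINT x|lborel. F x)"
proof -
  let ?\<psi> = "psi \<gamma> \<omega> z \<xi>"
  define w where "w = \<i> * of_real (\<xi> powr (1 / \<gamma>))"
  have w: "w \<in> uhp" using \<xi> by (simp add: w_def uhp_def)
  have \<psi>w: "?\<psi> w = z" unfolding w_def by (rule psi_vertex_preimage[OF \<gamma>(1) \<xi>(1)])
  define h where "h = (\<lambda>i j u. g (?\<psi> u) $ i $ j)"
  have psi: "?\<psi> u \<in> uhp" if "u \<in> uhp_closed" for u using psi_uhp[where \<omega> = \<omega> and z = z, OF \<gamma> \<omega> \<xi> that] .
  have g_hol: "(\<lambda>\<zeta>. g \<zeta> $ i $ j) holomorphic_on uhp" for i j using g by (simp add: analytic_mat_def)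
  have cont: "continuous_on uhp_closed (h i j)" for i j
    unfolding h_def using psi
    by (intro continuous_on_compose2[OF holomorphic_on_imp_continuous_on[OF g_hol] continuous_on_psi[OF \<gamma>(1)]]) auto
  have "((\<lambda>\<zeta>. g \<zeta> $ i $ j) \<circ> ?\<psi>) holomorphic_on uhp" for i j
    by (rule holomorphic_on_compose_gen[OF holomorphic_on_psi g_hol])
       (use psi in \<open>auto simp: uhp_def uhp_closed_def\<close>)
  hence hol: "h i j holomorphic_on uhp" for i j by (simp add: h_def o_def)
  have "\<exists>B. \<forall>u\<in>uhp_closed. cmod (h i j u) \<le> B * (1 + cmod u) powr - \<gamma>" for i j
  proof -
    have "cmod (g \<zeta> $ i $ j) \<le> C / Im \<zeta>" if "0 < Im \<zeta>" "\<eta> \<le> Im \<zeta>" for \<zeta>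
      using cmod_entry_le_op_norm[of "g \<zeta>" i j] decay[OF that] by linarith
    from decay_along_psi[where \<omega> = \<omega> and z = z, OF \<gamma> \<omega> \<xi> holomorphic_on_imp_continuous_on[OF g_hol] this] show ?thesis
      unfolding h_def by metis
  qed
  then obtain B where B: "\<And>i j u. u \<in> uhp_closed \<Longrightarrow> cmod (h i j u) \<le> B i j * (1 + cmod u) powr - \<gamma>"
    by metis
  have inside: "integrable lborel (\<lambda>x. h i j (of_real x) / (of_real x - w))"
      "(LINT x|lborel. h i j (of_real x) / (of_real x - w)) = 2 * pi * \<i> * h i j w" for i j
    by (rule Cauchy_formula_upper_half_plane[OF \<gamma>(1) cont hol B w]; assumption)+
  have "integrable lborel (\<lambda>x. h j i (of_real x) / (of_real x - cnj w))"
      "(LINT x|lborel. h j i (of_real x) / (of_real x - cnj w)) = 0" for i j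
    by (rule Cauchy_formula_upper_half_plane_outside[OF \<gamma>(1) cont hol B w]; assumption)+
  hence outside: "integrable lborel (\<lambda>x. cnj (h j i (of_real x) / (of_real x - cnj w)))"
      "(LINT x|lborel. cnj (h j i (of_real x) / (of_real x - cnj w))) = 0" for i j
    unfolding Bochner_Integration.integral_cnj by (simp_all only: integrable_cnj complex_cnj_zero)
  have F: "F x $ i $ j = (1 / (2 * \<i>)) * (h i j (of_real x) / (of_real x - w) - cnj (h j i (of_real x) / (of_real x - cnj w)))"
    for x i j
    by (simp add: F_def h_def w_def cscale_def Im_mat_def adj_def diff_divide_distrib[symmetric] mult_ac)
  have int: "integrable lborel (\<lambda>x. F x $ i $ j)" for i j
    unfolding F by (intro integrable_mult_right Bochner_Integration.integrable_diff inside outside)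
  have val: "(LINT x|lborel. F x $ i $ j) = pi * h i j w" for i j
  proof -
    have "(LINT x|lborel. F x $ i $ j) = (1 / (2 * \<i>)) * (2 * pi * \<i> * h i j w)"
      unfolding F
      by (simp only: integral_mult_right_zero Bochner_Integration.integral_diff inside outside diff_zero)
    thus ?thesis by (simp add: complex_eq_iff)
  qed
  show "integrable lborel F" by (rule bochner_integral_matrix(1)[OF int])
  show "g z = (1 / pi) *\<^sub>R (LINT x|lborel. F x)"
    by (simp add: vec_eq_iff bochner_integral_matrix(2)[OF int] val h_def \<psi>w) (simp add: scaleR_conv_of_real)
qed

section \<open>The vector Dyson equation\<close>

lemma Im_S_apply: "Im (S_apply S m $ j) = (\<Sum>k\<in>UNIV. S $ j $ k * Im (m $ k))"
  by (simp add: S_apply_def)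

lemma Im_S_apply_nonneg:
  assumes "\<And>j k. 0 \<le> S $ j $ k" "m \<in> uhp_vec"
  shows "0 \<le> Im (S_apply S m $ j)"
  unfolding Im_S_apply using assms by (auto intro!: sum_nonneg mult_nonneg_nonneg simp: uhp_vec_def uhp_def less_imp_le)

lemma bounded_linear_S_apply: "bounded_linear (S_apply S)"
  by (rule linear_conv_bounded_linear[THEN iffD1], rule linearI)
     (simp_all add: S_apply_def vec_eq_iff sum.distrib ring_distribs scaleR_sum_right)

text \<open>Taking imaginary parts in the Dyson equation ties \<open>\<bar>m\<bar>\<^sup>2\<close> to \<open>Im m\<close>. The a priori bound on
solutions, the Schwarz-Pick inequality and the stability of the equation all come from this balance.\<close>

lemma dyson_Im_balance:
  fixes a :: "real^'n"
  assumes "dyson_eq a S w m" "m \<in> uhp_vec"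
  shows "Im (m $ j) = (cmod (m $ j))\<^sup>2 * (Im (w $ j) + Im (S_apply S m $ j))"
proof -
  have m: "m $ j \<noteq> 0" using assms(2) by (auto simp: uhp_vec_def uhp_def dest: spec[of _ j])
  have "Im (- 1 / m $ j) = Im (w $ j) + Im (S_apply S m $ j)"
    using assms(1) by (simp add: dyson_eq_def)
  moreover have "Im (- 1 / m $ j) = Im (m $ j) / (cmod (m $ j))\<^sup>2"
    by (simp add: Im_divide cmod_def)
  ultimately show ?thesis using m by (simp add: field_simps)
qed

lemma norm_dyson_le:
  assumes "\<And>j k. 0 \<le> S $ j $ k" "w \<in> uhp_vec" "dyson_eq a S w m" "m \<in> uhp_vec"
  shows "cmod (m $ j) \<le> 1 / Im (w $ j)"
proof -
  have w: "0 < Im (w $ j)" using assms(2) by (simp add: uhp_vec_def uhp_def)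
  have "Im (w $ j) * (cmod (m $ j))\<^sup>2 \<le> Im (m $ j)"
    using dyson_Im_balance[OF assms(3,4), of j] Im_S_apply_nonneg[OF assms(1,4), of j]
    by (simp add: algebra_simps)
  also have "\<dots> \<le> cmod (m $ j)" using abs_Im_le_cmod[of "m $ j"] by linarith
  finally have "Im (w $ j) * cmod (m $ j) \<le> 1 \<or> m $ j = 0"
    using mult_le_cancel_right[of "Im (w $ j) * cmod (m $ j)" "cmod (m $ j)" 1]
    by (auto simp: power2_eq_square mult.assoc)
  thus ?thesis using w by (auto simp: field_simps)
qed

text \<open>The map \<open>m \<mapsto> -1/(w - a + S m)\<close> preserves a compact convex set. The upper bound \<open>1/Im w\<close> on \<open>\<bar>m\<bar>\<close>
holds for every value of the map since the denominator has imaginary part at least \<open>Im w\<close>. Where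
\<open>m\<close> obeys this bound the denominator has modulus at most \<open>b\<close>, which in turn keeps \<open>Im m\<close> above \<open>c > 0\<close>. Brouwer's theorem applies.\<close>

proposition dyson_solution_exists:
  fixes a :: "real^'n"
  assumes S: "\<And>j k. 0 \<le> S $ j $ k" and w: "w \<in> uhp_vec"
  shows "\<exists>m \<in> uhp_vec. dyson_eq a S w m"
proof -
  have Imw: "0 < Im (w $ j)" for j using w by (simp add: uhp_vec_def uhp_def)
  define b where "b = (\<lambda>j. cmod (w $ j - of_real (a $ j)) + (\<Sum>k\<in>UNIV. S $ j $ k / Im (w $ k)))"
  define c where "c = (\<lambda>j. Im (w $ j) / (b j)\<^sup>2)"
  define den where "den = (\<lambda>m j. w $ j - of_real (a $ j) + S_apply S m $ j)"
  define \<Phi> where "\<Phi> = (\<lambda>m :: complex^'n. (\<chi> j. - 1 / den m j))"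
  define K where "K = {m. \<forall>j. c j \<le> Im (m $ j) \<and> cmod (m $ j) \<le> 1 / Im (w $ j)}"
  have b: "0 < b j" for j
  proof -
    have "0 < Im (w $ j - of_real (a $ j))" using Imw by simp
    hence "0 < cmod (w $ j - of_real (a $ j))"
      using abs_Im_le_cmod[of "w $ j - of_real (a $ j)"] by linarith
    moreover have "0 \<le> (\<Sum>k\<in>UNIV. S $ j $ k / Im (w $ k))"
      using S Imw by (intro sum_nonneg) (simp add: less_imp_le)
    ultimately show ?thesis unfolding b_def by (rule add_pos_nonneg)
  qed
  have c: "0 < c j" for j using b[of j] Imw[of j] by (simp add: c_def)
  have K_nonneg: "0 \<le> Im (S_apply S m $ j)" if "m \<in> K" for m j
    by (rule Im_S_apply_nonneg[OF S]) (use that c in \<open>auto simp: K_def uhp_vec_def uhp_def intro: less_le_trans\<close>)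
  have den_Im: "Im (w $ j) \<le> Im (den m j)" if "m \<in> K" for m j
    using K_nonneg[OF that, of j] by (simp add: den_def)
  have den_ne: "den m j \<noteq> 0" if "m \<in> K" for m j
    using den_Im[OF that, of j] Imw[of j] by auto
  have map: "\<Phi> \<in> K \<rightarrow> K"
  proof
    fix m assume m: "m \<in> K"
    show "\<Phi> m \<in> K" unfolding K_def
    proof (intro CollectI allI conjI)
      fix j
      have "cmod (S_apply S m $ j) \<le> (\<Sum>k\<in>UNIV. S $ j $ k / Im (w $ k))"
        unfolding S_apply_def vec_lambda_beta
      proof (intro sum_norm_le)
        fix k
        have "S $ j $ k * cmod (m $ k) \<le> S $ j $ k * (1 / Im (w $ k))"
          using m S by (intro mult_left_mono) (auto simp: K_def)
        thus "cmod (of_real (S $ j $ k) * m $ k) \<le> S $ j $ k / Im (w $ k)"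
          using S by (simp add: norm_mult)
      qed
      hence up: "cmod (den m j) \<le> b j"
        unfolding den_def b_def by (intro norm_triangle_mono) auto
      have "c j \<le> Im (w $ j) / (cmod (den m j))\<^sup>2"
        unfolding c_def using up Imw[of j] den_ne[OF m, of j] b[of j]
        by (intro divide_left_mono power_mono) auto
      also have "\<dots> \<le> Im (den m j) / (cmod (den m j))\<^sup>2"
        using den_Im[OF m] by (intro divide_right_mono) auto
      also have "\<dots> = Im (\<Phi> m $ j)" by (simp add: \<Phi>_def Im_divide cmod_def)
      finally show "c j \<le> Im (\<Phi> m $ j)" .
      have "Im (w $ j) \<le> cmod (den m j)"
        using den_Im[OF m, of j] abs_Im_le_cmod[of "den m j"] by linarith
      thus "cmod (\<Phi> m $ j) \<le> 1 / Im (w $ j)"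
        using Imw[of j] by (simp add: \<Phi>_def norm_divide divide_simps)
    qed
  qed
  have K_alt: "K = (\<Inter>j. (\<lambda>m. m $ j) -` ({x. c j \<le> Im x} \<inter> cball 0 (1 / Im (w $ j))))"
    by (auto simp: K_def)
  have "convex K"
    unfolding K_alt
    by (intro convex_INT ballI convex_linear_vimage convex_Int convex_cball convex_halfspace_Im_ge)
       (simp add: linear_iff)
  moreover have "compact K"
  proof -
    have "closed K" unfolding K_def
      by (intro closed_Collect_all closed_Collect_conj closed_Collect_le continuous_intros)
    moreover have "bounded K"
    proof (rule boundedI)
      fix m assume m: "m \<in> K"
      have "norm m \<le> (\<Sum>j\<in>UNIV. cmod (m $ j))" by (simp add: norm_vec_def L2_set_le_sum)
      also have "\<dots> \<le> (\<Sum>j\<in>UNIV. 1 / Im (w $ j))" using m by (intro sum_mono) (auto simp: K_def)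
      finally show "norm m \<le> (\<Sum>j\<in>UNIV. 1 / Im (w $ j))" .
    qed
    ultimately show ?thesis by (simp add: compact_eq_bounded_closed)
  qed
  moreover have "K \<noteq> {}"
  proof -
    have "(\<chi> j. \<i> * of_real (c j)) \<in> K"
    proof -
      have "Im (w $ j) \<le> b j" for j
        using abs_Im_le_cmod[of "w $ j - of_real (a $ j)"] S Imw
        unfolding b_def by (smt (verit) Im_complex_of_real minus_complex.sel(2) sum_nonneg divide_nonneg_pos)
      hence "Im (w $ j) * Im (w $ j) \<le> (b j)\<^sup>2" for j
        using Imw[of j] unfolding power2_eq_square
        by (metis less_imp_le mult_mono order_trans)
      hence "c j \<le> 1 / Im (w $ j)" for j
        using Imw[of j] b[of j] by (simp add: c_def field_simps)
      thus ?thesis using c by (simp add: K_def norm_mult less_imp_le)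
    qed
    thus ?thesis by blast
  qed
  moreover have "continuous_on K \<Phi>"
    unfolding \<Phi>_def using den_ne
    by (intro continuous_on_vec_lambda continuous_intros)
       (auto simp: den_def S_apply_def intro!: continuous_intros)
  ultimately obtain m where m: "m \<in> K" "\<Phi> m = m" using brouwer map by metis
  have "m \<in> uhp_vec" using m(1) c by (auto simp: K_def uhp_vec_def uhp_def intro: less_le_trans)
  moreover have "dyson_eq a S w m"
    unfolding dyson_eq_def
  proof
    fix j
    have "m $ j = - 1 / den m j" using m(2) by (metis \<Phi>_def vec_lambda_beta)
    thus "- 1 / m $ j = w $ j - of_real (a $ j) + S_apply S m $ j"
      using den_ne[OF m(1), of j] by (simp add: den_def)
  qed
  ultimately show ?thesis by blast
qed

text \<open>The two-dimensional Cauchy-Schwarz inequality.\<close>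

lemma sqrt_mult_add_le:
  fixes a b c d :: real
  assumes "0 \<le> a" "0 \<le> b" "0 \<le> c" "0 \<le> d"
  shows "sqrt (a * c) + sqrt (b * d) \<le> sqrt ((a + b) * (c + d))"
proof (rule real_le_rsqrt)
  have "2 * (sqrt (a * c) * sqrt (b * d)) = 2 * (sqrt (a * d) * sqrt (b * c))"
    by (simp add: real_sqrt_mult)
  also have "\<dots> \<le> (sqrt (a * d))\<^sup>2 + (sqrt (b * c))\<^sup>2"
    using sum_squares_bound[of "sqrt (a * d)" "sqrt (b * c)"] by simp
  finally show "(sqrt (a * c) + sqrt (b * d))\<^sup>2 \<le> (a + b) * (c + d)"
    using assms by (simp add: power2_sum algebra_simps)
qed

lemma Im_weighted_Cauchy_Schwarz:
  assumes S: "\<And>j k. 0 \<le> S $ j $ k" and m: "m \<in> uhp_vec" "m' \<in> uhp_vec"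
  shows "(\<Sum>k\<in>UNIV. S $ j $ k * sqrt (Im (m $ k) * Im (m' $ k)))
     \<le> sqrt (Im (S_apply S m $ j) * Im (S_apply S m' $ j))"
proof -
  have pos: "0 \<le> Im (m $ k)" "0 \<le> Im (m' $ k)" for k
    using m by (auto simp: uhp_vec_def uhp_def less_imp_le)
  have "(\<Sum>k\<in>UNIV. S $ j $ k * sqrt (Im (m $ k) * Im (m' $ k)))
      = (\<Sum>k\<in>UNIV. sqrt (S $ j $ k * Im (m $ k)) * sqrt (S $ j $ k * Im (m' $ k)))"
    using S pos by (intro sum.cong) (auto simp: real_sqrt_mult)
  also have "\<dots> \<le> L2_set (\<lambda>k. sqrt (S $ j $ k * Im (m $ k))) UNIV * L2_set (\<lambda>k. sqrt (S $ j $ k * Im (m' $ k))) UNIV"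
    using L2_set_mult_ineq[of "\<lambda>k. sqrt (S $ j $ k * Im (m $ k))" "\<lambda>k. sqrt (S $ j $ k * Im (m' $ k))" UNIV]
      S pos by simp
  also have "\<dots> = sqrt (Im (S_apply S m $ j) * Im (S_apply S m' $ j))"
    using S pos by (simp add: L2_set_def Im_S_apply flip: real_sqrt_mult)
  finally show ?thesis .
qed

text \<open>For \<open>d\<close> the hyperbolic distance of \<open>m\<close> and \<open>m'\<close>, the quotient \<open>\<bar>m - m'\<bar> / \<surd>(Im m Im m')\<close> equals
\<open>2 sinh (d/2)\<close>; so the solution map does not increase the largest componentwise distance. Subtracting
the two equations gives \<open>m - m' = m m' (w - w' + S (m - m'))\<close>, and \<open>dyson_Im_balance\<close> rewrites
\<open>\<bar>m m'\<bar> / \<surd>(Im m Im m')\<close> as \<open>1 / \<surd>((Im w + S Im m) (Im w' + S Im m'))\<close>. If \<open>D\<close> is the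
largest of these quotients, Cauchy-Schwarz bounds the contribution of \<open>S (m - m')\<close> by
\<open>D \<surd>(S Im m \<cdot> S Im m')\<close>, while the denominator is at least
\<open>\<surd>(Im w Im w') + \<surd>(S Im m \<cdot> S Im m')\<close>; so this contribution is absorbed, and the surplus
\<open>\<surd>(Im w Im w')\<close> controls \<open>D\<close>.\<close>

proposition dyson_Schwarz_Pick:
  fixes a :: "real^'n"
  assumes S: "\<And>j k. 0 \<le> S $ j $ k" and w: "w \<in> uhp_vec" "w' \<in> uhp_vec"
    and m: "m \<in> uhp_vec" "dyson_eq a S w m" and m': "m' \<in> uhp_vec" "dyson_eq a S w' m'"
  shows "\<exists>k. cmod (m $ j - m' $ j) / sqrt (Im (m $ j) * Im (m' $ j))
     \<le> cmod (w $ k - w' $ k) / sqrt (Im (w $ k) * Im (w' $ k))"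
proof -
  define d where "d = (\<lambda>j. cmod (m $ j - m' $ j) / sqrt (Im (m $ j) * Im (m' $ j)))"
  define D where "D = Max (range d)"
  have dD: "d k \<le> D" for k unfolding D_def by simp
  obtain k where k: "d k = D" unfolding D_def using Max_in[of "range d"] by fastforce
  have pos: "0 < Im (m $ k)" "0 < Im (m' $ k)" "0 < Im (w $ k)" "0 < Im (w' $ k)" for k
    using w m m' by (auto simp: uhp_vec_def uhp_def)
  have D0: "0 \<le> D" using k pos[of k] by (auto simp: d_def simp flip: k)
  have ne: "m $ k \<noteq> 0" "m' $ k \<noteq> 0" using pos[of k] by auto
  \<comment> \<open>From here on everything is evaluated at the maximizing index \<open>k\<close>.\<close>
  let ?s = "Im (S_apply S m $ k)" and ?s' = "Im (S_apply S m' $ k)"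
  have s: "0 \<le> ?s" "0 \<le> ?s'" using Im_S_apply_nonneg[OF S] m m' by auto
  have "- 1 / m $ k - (- 1 / m' $ k) = (w $ k - w' $ k) + (S_apply S m $ k - S_apply S m' $ k)"
    using m m' by (simp add: dyson_eq_def)
  hence diff: "m $ k - m' $ k = m $ k * m' $ k * ((w $ k - w' $ k) + (S_apply S m $ k - S_apply S m' $ k))"
    using ne by (simp add: field_simps)
  have "cmod (S_apply S m $ k - S_apply S m' $ k) \<le> (\<Sum>l\<in>UNIV. D * (S $ k $ l * sqrt (Im (m $ l) * Im (m' $ l))))"
    unfolding S_apply_def vec_lambda_beta sum_subtractf[symmetric]
  proof (intro sum_norm_le)
    fix l
    have "cmod (m $ l - m' $ l) \<le> D * sqrt (Im (m $ l) * Im (m' $ l))"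
      using dD[of l] pos[of l] by (simp add: d_def field_simps)
    hence "S $ k $ l * cmod (m $ l - m' $ l) \<le> S $ k $ l * (D * sqrt (Im (m $ l) * Im (m' $ l)))"
      using S by (intro mult_left_mono) auto
    moreover have "cmod (of_real (S $ k $ l) * m $ l - of_real (S $ k $ l) * m' $ l) = S $ k $ l * cmod (m $ l - m' $ l)"
      using S by (simp add: norm_mult flip: right_diff_distrib)
    ultimately show "cmod (of_real (S $ k $ l) * m $ l - of_real (S $ k $ l) * m' $ l) \<le> D * (S $ k $ l * sqrt (Im (m $ l) * Im (m' $ l)))"
      by (simp add: mult_ac)
  qed
  also have "\<dots> \<le> D * sqrt (?s * ?s')"
    unfolding sum_distrib_left[symmetric]
    by (intro mult_left_mono Im_weighted_Cauchy_Schwarz S m m' D0)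
  finally have Sdiff: "cmod (S_apply S m $ k - S_apply S m' $ k) \<le> D * sqrt (?s * ?s')" .
  let ?q = "sqrt ((Im (w $ k) + ?s) * (Im (w' $ k) + ?s'))"
  have q: "0 < ?q" using pos[of k] s by (simp add: add_pos_nonneg)
  have "sqrt (Im (m $ k) * Im (m' $ k)) = cmod (m $ k) * cmod (m' $ k) * ?q"
    by (subst dyson_Im_balance[OF m(2,1)], subst dyson_Im_balance[OF m'(2,1)])
       (simp add: real_sqrt_mult mult_ac)
  hence "D = cmod ((w $ k - w' $ k) + (S_apply S m $ k - S_apply S m' $ k)) / ?q"
    unfolding k[symmetric] d_def using ne q by (subst diff) (simp add: norm_mult divide_simps)
  hence "D * ?q \<le> cmod (w $ k - w' $ k) + D * sqrt (?s * ?s')"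
    using Sdiff q norm_triangle_ineq[of "w $ k - w' $ k" "S_apply S m $ k - S_apply S m' $ k"] by simp
  moreover have "D * (sqrt (Im (w $ k) * Im (w' $ k)) + sqrt (?s * ?s')) \<le> D * ?q"
    using pos[of k] s D0 by (intro mult_left_mono sqrt_mult_add_le) auto
  ultimately have "D * sqrt (Im (w $ k) * Im (w' $ k)) \<le> cmod (w $ k - w' $ k)"
    by (simp add: distrib_left)
  hence "D \<le> cmod (w $ k - w' $ k) / sqrt (Im (w $ k) * Im (w' $ k))"
    using pos[of k] by (simp add: field_simps)
  thus ?thesis using dD[of j] unfolding d_def by (meson order_trans)
qed

lemma dyson_solution_unique:
  assumes "\<And>j k. 0 \<le> S $ j $ k" "w \<in> uhp_vec"
    and "m \<in> uhp_vec" "dyson_eq a S w m" "m' \<in> uhp_vec" "dyson_eq a S w m'"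
  shows "m = m'"
proof -
  have "m $ j = m' $ j" for j
  proof -
    have "0 < sqrt (Im (m $ j) * Im (m' $ j))" using assms(3,5) by (auto simp: uhp_vec_def uhp_def)
    moreover have "cmod (m $ j - m' $ j) / sqrt (Im (m $ j) * Im (m' $ j)) \<le> 0"
      using dyson_Schwarz_Pick[OF assms(1,2,2-6), of j] by simp
    ultimately show ?thesis by (simp add: divide_le_0_iff)
  qed
  thus ?thesis by (simp add: vec_eq_iff)
qed

lemma m_vec_solves:
  assumes "\<And>j k. 0 \<le> S $ j $ k" "w \<in> uhp_vec"
  shows "m_vec a S w \<in> uhp_vec" "dyson_eq a S w (m_vec a S w)"
proof -
  have "\<exists>!m. m \<in> uhp_vec \<and> dyson_eq a S w m"
    using dyson_solution_exists[OF assms, of a] dyson_solution_unique[OF assms] by blast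
  from theI'[OF this] show "m_vec a S w \<in> uhp_vec" "dyson_eq a S w (m_vec a S w)"
    using assms(2) by (simp_all add: m_vec_def)
qed

lemma m_vec_eqI:
  assumes "\<And>j k. 0 \<le> S $ j $ k" "w \<in> uhp_vec" "m \<in> uhp_vec" "dyson_eq a S w m"
  shows "m_vec a S w = m"
  using dyson_solution_unique[OF assms(1,2) m_vec_solves[OF assms(1,2)] assms(3,4)] .

section \<open>Smooth and holomorphic dependence on the spectral parameter\<close>

text \<open>The Dyson equation solved for the spectral parameter: the left inverse of the solution map.\<close>

definition dyson_param :: "real^'n \<Rightarrow> real^'n^'n \<Rightarrow> complex^'n \<Rightarrow> complex^'n" where
  "dyson_param a S m = (\<chi> j. of_real (a $ j) - 1 / m $ j - S_apply S m $ j)"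

definition dyson_param_deriv :: "real^'n^'n \<Rightarrow> complex^'n \<Rightarrow> complex^'n \<Rightarrow> complex^'n" where
  "dyson_param_deriv S m h = (\<chi> j. h $ j / (m $ j)\<^sup>2 - S_apply S h $ j)"

lemma dyson_eq_iff_param: "dyson_eq a S w m \<longleftrightarrow> w = dyson_param a S m"
  unfolding dyson_eq_def dyson_param_def vec_eq_iff
  by (simp add: algebra_simps) (metis (no_types, opaque_lifting) add.commute minus_diff_eq neg_eq_iff_add_eq_0 diff_add_cancel add_diff_cancel)

lemma has_derivative_vec_lambda:
  fixes f :: "'b::real_normed_vector \<Rightarrow> 'a::euclidean_space^'n"
  assumes "\<And>j. ((\<lambda>x. f x $ j) has_derivative (\<lambda>h. f' h $ j)) (at x within s)"
  shows "(f has_derivative f') (at x within s)"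
  by (rule has_derivative_componentwise_within[THEN iffD2])
     (use assms in \<open>auto simp: Basis_vec_def inner_axis intro!: has_derivative_inner_left\<close>)

lemma dyson_param_has_derivative:
  assumes "m \<in> uhp_vec"
  shows "(dyson_param a S has_derivative dyson_param_deriv S m) (at m within A)"
proof (rule has_derivative_vec_lambda)
  fix j
  have m: "m $ j \<noteq> 0" using assms by (auto simp: uhp_vec_def uhp_def dest: spec[of _ j])
  have S: "((\<lambda>m. S_apply S m $ j) has_derivative (\<lambda>h. S_apply S h $ j)) (at m within A)"
    by (intro bounded_linear_imp_has_derivative bounded_linear_compose[OF bounded_linear_vec_nth bounded_linear_S_apply])
  have id: "((\<lambda>m. m $ j) has_derivative (\<lambda>h. h $ j)) (at m within A)"
    by (intro bounded_linear_imp_has_derivative bounded_linear_vec_nth)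
  have "((\<lambda>m. of_real (a $ j) - 1 / m $ j - S_apply S m $ j) has_derivative
      (\<lambda>h. h $ j / (m $ j)\<^sup>2 - S_apply S h $ j)) (at m within A)"
    using m by (auto intro!: derivative_eq_intros S id simp: power2_eq_square divide_inverse)
  thus "((\<lambda>m. dyson_param a S m $ j) has_derivative (\<lambda>h. dyson_param_deriv S m h $ j)) (at m within A)"
    by (simp add: dyson_param_def dyson_param_deriv_def)
qed

lemma linear_dyson_param_deriv: "linear (dyson_param_deriv S m)"
  using linear_simps[OF bounded_linear_S_apply[of S]]
  by (intro linearI) (auto simp: dyson_param_deriv_def vec_eq_iff add_divide_distrib algebra_simps scaleR_conv_of_real)

lemma dyson_param_deriv_complex_scale:
  "dyson_param_deriv S m (\<chi> j. c * h $ j) = (\<chi> j. c * dyson_param_deriv S m h $ j)"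
  by (simp add: dyson_param_deriv_def S_apply_def vec_eq_iff sum_distrib_left algebra_simps)

text \<open>Stability of the Dyson equation. If \<open>h = m\<^sup>2 S h\<close>, let \<open>D\<close> be the maximum of \<open>\<bar>h\<bar>/Im m\<close>. At the maximizing
index \<open>D Im m \<le> D \<bar>m\<bar>\<^sup>2 S Im m\<close>, whereas \<open>\<bar>m\<bar>\<^sup>2 S Im m < Im m\<close> by \<open>dyson_Im_balance\<close> because
\<open>Im w > 0\<close>. So \<open>D = 0\<close>.\<close>

lemma dyson_param_deriv_eq_0:
  assumes S: "\<And>j k. 0 \<le> S $ j $ k" and w: "w \<in> uhp_vec"
    and m: "m \<in> uhp_vec" "dyson_eq a S w m" and h: "dyson_param_deriv S m h = 0"
  shows "h = 0"
proof -
  have pos: "0 < Im (m $ k)" "0 < Im (w $ k)" for k using m w by (auto simp: uhp_vec_def uhp_def)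
  define d where "d = (\<lambda>j. cmod (h $ j) / Im (m $ j))"
  define D where "D = Max (range d)"
  have dD: "d k \<le> D" for k unfolding D_def by simp
  obtain k where k: "d k = D" unfolding D_def using Max_in[of "range d"] by fastforce
  have D0: "0 \<le> D" using pos[of k] by (simp add: d_def flip: k)
  have "m $ k \<noteq> 0" using pos[of k] by auto
  moreover have "h $ k / (m $ k)\<^sup>2 = S_apply S h $ k"
    using h by (simp add: dyson_param_deriv_def vec_eq_iff)
  ultimately have hk: "h $ k = (m $ k)\<^sup>2 * S_apply S h $ k" by (simp add: field_simps)
  have "cmod (S_apply S h $ k) \<le> (\<Sum>l\<in>UNIV. D * (S $ k $ l * Im (m $ l)))"
    unfolding S_apply_def vec_lambda_beta
  proof (intro sum_norm_le)
    fix l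
    have "cmod (h $ l) \<le> D * Im (m $ l)" using dD[of l] pos[of l] by (simp add: d_def field_simps)
    hence "S $ k $ l * cmod (h $ l) \<le> S $ k $ l * (D * Im (m $ l))" using S by (intro mult_left_mono)
    thus "cmod (of_real (S $ k $ l) * h $ l) \<le> D * (S $ k $ l * Im (m $ l))"
      using S by (simp add: norm_mult mult_ac)
  qed
  also have "\<dots> = D * Im (S_apply S m $ k)" by (simp add: Im_S_apply sum_distrib_left)
  finally have "(cmod (m $ k))\<^sup>2 * cmod (S_apply S h $ k) \<le> (cmod (m $ k))\<^sup>2 * (D * Im (S_apply S m $ k))"
    by (intro mult_left_mono) auto
  hence "cmod (h $ k) \<le> D * ((cmod (m $ k))\<^sup>2 * Im (S_apply S m $ k))"
    by (subst hk) (simp add: norm_mult norm_power mult_ac)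
  moreover have "cmod (h $ k) = D * Im (m $ k)" using pos[of k] by (simp add: d_def flip: k)
  moreover have "(cmod (m $ k))\<^sup>2 * Im (S_apply S m $ k) < Im (m $ k)"
    using dyson_Im_balance[OF m(2,1), of k] pos[of k] \<open>m $ k \<noteq> 0\<close> by (simp add: distrib_left)
  ultimately have "D = 0"
    using D0 by (metis antisym_conv2 linorder_not_le mult_less_cancel_left_pos order_le_less)
  hence "h $ j = 0" for j using dD[of j] pos[of j] by (simp add: d_def divide_le_0_iff)
  thus ?thesis by (simp add: vec_eq_iff)
qed

lemma open_uhp_vec: "open (uhp_vec :: (complex^'n) set)"
proof -
  have "uhp_vec = (\<Inter>j. (\<lambda>v :: complex^'n. v $ j) -` {z. 0 < Im z})"
    by (auto simp: uhp_vec_def uhp_def)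
  also have "open \<dots>"
    by (intro open_INT ballI open_vimage_vec_nth open_halfspace_Im_gt) simp
  finally show ?thesis .
qed

text \<open>The Schwarz-Pick inequality is a local Lipschitz bound, because the imaginary parts of solutions are
bounded by \<open>1/Im w\<close>.\<close>

lemma continuous_m_vec:
  fixes a :: "real^'n"
  assumes S: "\<And>j k. 0 \<le> S $ j $ k" and w: "w \<in> uhp_vec"
  shows "isCont (m_vec a S) w"
  unfolding isCont_def
proof (rule vec_tendstoI)
  fix j
  have pos: "0 < Im (v $ k)" if "v \<in> uhp_vec" for v :: "complex^'n" and k
    using that by (auto simp: uhp_vec_def uhp_def)
  let ?b = "\<lambda>w'. (\<Sum>k\<in>UNIV. cmod (w' $ k - w $ k) / sqrt (Im (w' $ k) * Im (w $ k))) * sqrt (1 / Im (w' $ j) * (1 / Im (w $ j)))"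
  have "((\<lambda>w'. m_vec a S w' $ j - m_vec a S w $ j) \<longlongrightarrow> 0) (at w)"
  proof (rule Lim_null_comparison)
    have "\<forall>\<^sub>F w' in at w. w' \<in> uhp_vec"
      using open_uhp_vec w by (metis eventually_at_topological)
    thus "\<forall>\<^sub>F w' in at w. cmod (m_vec a S w' $ j - m_vec a S w $ j) \<le> ?b w'"
    proof eventually_elim
      case (elim w')
      note sol = m_vec_solves[OF S elim, of a] m_vec_solves[OF S w, of a]
      let ?m = "m_vec a S w" and ?m' = "m_vec a S w'"
      have m: "0 < Im (?m $ j)" "0 < Im (?m' $ j)" using pos sol by auto
      have le: "Im (?m' $ j) \<le> 1 / Im (w' $ j)" "Im (?m $ j) \<le> 1 / Im (w $ j)"
        using norm_dyson_le[OF S elim sol(2,1), of j] norm_dyson_le[OF S w sol(4,3), of j]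
          abs_Im_le_cmod[of "?m $ j"] abs_Im_le_cmod[of "?m' $ j"] by linarith+
      obtain k where "cmod (?m' $ j - ?m $ j) / sqrt (Im (?m' $ j) * Im (?m $ j))
          \<le> cmod (w' $ k - w $ k) / sqrt (Im (w' $ k) * Im (w $ k))"
        using dyson_Schwarz_Pick[OF S elim w sol] by blast
      also have "\<dots> \<le> (\<Sum>k\<in>UNIV. cmod (w' $ k - w $ k) / sqrt (Im (w' $ k) * Im (w $ k)))"
        using pos[OF elim] pos[OF w]
        by (intro member_le_sum) (auto intro!: divide_nonneg_nonneg simp: less_imp_le)
      finally have "cmod (?m' $ j - ?m $ j) \<le>
          (\<Sum>k\<in>UNIV. cmod (w' $ k - w $ k) / sqrt (Im (w' $ k) * Im (w $ k))) * sqrt (Im (?m' $ j) * Im (?m $ j))"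
        using m by (simp add: pos_divide_le_eq)
      also have "\<dots> \<le> ?b w'"
        using pos[OF elim] pos[OF w] le m
        by (intro mult_left_mono sum_nonneg real_sqrt_le_mono mult_mono) (auto simp: less_imp_le)
      finally show ?case .
    qed
    have "(?b \<longlongrightarrow> (\<Sum>k\<in>UNIV. cmod (w $ k - w $ k) / sqrt (Im (w $ k) * Im (w $ k))) * sqrt (1 / Im (w $ j) * (1 / Im (w $ j)))) (at w)"
      using pos[OF w] by (intro tendsto_intros) (auto simp: less_le)
    thus "(?b \<longlongrightarrow> 0) (at w)" by simp
  qed
  thus "((\<lambda>w'. m_vec a S w' $ j) \<longlongrightarrow> m_vec a S w $ j) (at w)" by (simp add: LIM_zero_iff)
qed

text \<open>The solution map is a continuous right inverse of \<open>dyson_param\<close>, whose derivative is invertible at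
solutions; so it is differentiable with the inverse derivative.\<close>

proposition m_vec_has_derivative:
  fixes a :: "real^'n"
  assumes S: "\<And>j k. 0 \<le> S $ j $ k" and w: "w \<in> uhp_vec"
  obtains g' where "(m_vec a S has_derivative g') (at w)"
    "\<And>h. g' (dyson_param_deriv S (m_vec a S w) h) = h"
    "surj (dyson_param_deriv S (m_vec a S w))"
proof -
  let ?L = "dyson_param_deriv S (m_vec a S w)"
  note sol = m_vec_solves[OF S w, of a]
  have "inj ?L"
    using dyson_param_deriv_eq_0[OF S w sol] linear_injective_0[OF linear_dyson_param_deriv] by blast
  moreover from this have "surj ?L"
    using linear_injective_imp_surjective linear_dyson_param_deriv by blast
  ultimately obtain g' where g': "linear g'" "g' \<circ> ?L = id"
    using linear_injective_left_inverse[OF linear_dyson_param_deriv] by blast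
  have "(m_vec a S has_derivative g') (at w)"
  proof (rule has_derivative_inverse_basic[where f = "dyson_param a S" and T = uhp_vec])
    show "(dyson_param a S has_derivative ?L) (at (m_vec a S w))"
      by (rule dyson_param_has_derivative[OF sol(1)])
    show "bounded_linear g'" using g'(1) by (simp add: linear_conv_bounded_linear)
    show "continuous (at w) (m_vec a S)" using continuous_m_vec[OF S w] .
    show "dyson_param a S (m_vec a S w') = w'" if "w' \<in> uhp_vec" for w'
      using m_vec_solves(2)[OF S that] by (simp add: dyson_eq_iff_param)
  qed (use open_uhp_vec w g'(2) in auto)
  thus thesis using that g' \<open>surj ?L\<close> by (metis comp_apply id_apply)
qed

text \<open>The derivative of the solution map inverts a complex-linear map. Hence its restriction to the
diagonal direction is multiplication by the fixed vector that \<open>dyson_param_deriv\<close> sends to the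
constant vector \<open>1\<close>.\<close>

lemma holomorphic_m_vec_const:
  fixes a :: "real^'n"
  assumes S: "\<And>j k. 0 \<le> S $ j $ k"
  shows "(\<lambda>\<zeta>. m_vec a S (const_vec \<zeta>) $ j) holomorphic_on uhp"
proof -
  have "\<exists>k. ((\<lambda>\<zeta>. m_vec a S (const_vec \<zeta>) $ j) has_field_derivative k) (at \<zeta>)" if "\<zeta> \<in> uhp" for \<zeta>
  proof -
    have w: "(const_vec \<zeta> :: complex^'n) \<in> uhp_vec" using that by (simp add: uhp_vec_def const_vec_def)
    obtain g' where g': "(m_vec a S has_derivative g') (at (const_vec \<zeta>))"
        "\<And>h. g' (dyson_param_deriv S (m_vec a S (const_vec \<zeta>)) h) = h"
        "surj (dyson_param_deriv S (m_vec a S (const_vec \<zeta>)))"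
      using m_vec_has_derivative[OF S w, of a] by metis
    obtain k where k: "dyson_param_deriv S (m_vec a S (const_vec \<zeta>)) k = const_vec 1"
      using g'(3) by (metis surjD)
    have lin: "g' (const_vec c) = (\<chi> j. c * k $ j)" for c
    proof -
      have "const_vec c = dyson_param_deriv S (m_vec a S (const_vec \<zeta>)) (\<chi> j. c * k $ j)"
        unfolding dyson_param_deriv_complex_scale k by (simp add: const_vec_def)
      thus ?thesis using g'(2) by metis
    qed
    have "((const_vec :: complex \<Rightarrow> complex^'n) has_derivative const_vec) (at \<zeta>)"
      by (rule has_derivative_vec_lambda) (simp add: const_vec_def)
    from has_derivative_compose[OF this g'(1)]
    have "((\<lambda>\<zeta>. m_vec a S (const_vec \<zeta>) $ j) has_derivative (\<lambda>c. g' (const_vec c) $ j)) (at \<zeta>)"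
      by (rule bounded_linear.has_derivative[OF bounded_linear_vec_nth])
    hence "((\<lambda>\<zeta>. m_vec a S (const_vec \<zeta>) $ j) has_field_derivative k $ j) (at \<zeta>)"
      by (simp add: has_field_derivative_def lin mult.commute[of _ "k $ j"])
    thus ?thesis by blast
  qed
  moreover have "open uhp" unfolding uhp_def by (rule open_halfspace_Im_gt)
  ultimately show ?thesis by (simp add: holomorphic_on_open)
qed

text \<open>With \<open>\<sigma> = Im (S m)\<close> one has \<open>Im (-1/m) = Im w + \<sigma>\<close>, so scaling by \<open>s\<close> gives the imaginary part
\<open>(Im w + \<sigma>)/s - s \<sigma>\<close>, which is smallest at \<open>s = 1\<close>.\<close>

lemma dyson_param_scaled_Im_ge:
  assumes S: "\<And>j k. 0 \<le> S $ j $ k" and w: "w \<in> uhp_vec"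
    and m: "m \<in> uhp_vec" "dyson_eq a S w m" and s: "0 < s" "s \<le> 1"
  shows "Im (w $ j) \<le> Im (dyson_param a S (s *\<^sub>R m) $ j)"
proof -
  let ?\<sigma> = "Im (S_apply S m $ j)"
  have \<sigma>: "0 \<le> ?\<sigma>" "0 < Im (w $ j)" using Im_S_apply_nonneg[OF S m(1)] w by (auto simp: uhp_vec_def uhp_def)
  have "- 1 / m $ j = w $ j - of_real (a $ j) + S_apply S m $ j"
    using m(2) by (simp add: dyson_eq_def)
  hence "Im (- (1 / m $ j)) = Im (w $ j) + ?\<sigma>" by simp
  moreover have "dyson_param a S (s *\<^sub>R m) $ j = of_real (a $ j) + (1 / s) *\<^sub>R (- (1 / m $ j)) - s *\<^sub>R S_apply S m $ j"
    using s by (simp add: dyson_param_def linear_simps(5)[OF bounded_linear_S_apply])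
      (simp add: scaleR_conv_of_real)
  hence "Im (dyson_param a S (s *\<^sub>R m) $ j) = (1 / s) * Im (- (1 / m $ j)) - s * ?\<sigma>"
    by (simp only: plus_complex.sel minus_complex.sel scaleR_complex.sel Im_complex_of_real add_0)
  ultimately have "Im (dyson_param a S (s *\<^sub>R m) $ j) = (Im (w $ j) + ?\<sigma>) / s - s * ?\<sigma>"
    by simp
  moreover have "Im (w $ j) + ?\<sigma> \<le> (Im (w $ j) + ?\<sigma>) / s"
    using s \<sigma> mult_right_mono[of s 1 "Im (w $ j) + ?\<sigma>"] by (simp add: le_divide_eq mult.commute)
  moreover have "s * ?\<sigma> \<le> ?\<sigma>" using s \<sigma> by (simp add: mult_left_le_one_le)
  ultimately show ?thesis by linarith
qed

section \<open>The characteristic flow\<close>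

text \<open>The trajectory through \<open>z\<close> at time \<open>T\<close>: along the flow the solution of the Dyson equation is merely
scaled by \<open>exp ((t - T)/2)\<close>.\<close>

definition char_flow :: "real^'n \<Rightarrow> real^'n^'n \<Rightarrow> real \<Rightarrow> complex \<Rightarrow> real \<Rightarrow> complex^'n" where
  "char_flow a S T z t = dyson_param a S (exp ((t - T) / 2) *\<^sub>R m_vec a S (const_vec z))"

text \<open>The reason why the flow is solvable in closed form: at \<open>w = \<Phi>(m)\<close> its right-hand side is the
derivative of \<open>\<Phi>\<close> in direction \<open>m/2\<close>.\<close>

lemma flow_rhs_eq:
  assumes "w = dyson_param a S m" 
  shows "- S_apply S m - (1 / 2) *\<^sub>R (w - (\<chi> j. of_real (a $ j))) = dyson_param_deriv S m ((1 / 2) *\<^sub>R m)"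
  unfolding assms dyson_param_deriv_def dyson_param_def linear_simps(5)[OF bounded_linear_S_apply]
  by (simp add: vec_eq_iff) (simp add: scaleR_conv_of_real field_simps power2_eq_square)

lemma const_vec_uhp: "z \<in> uhp \<Longrightarrow> const_vec z \<in> uhp_vec"
  by (simp add: uhp_vec_def const_vec_def)

lemma char_flow_Im_ge:
  fixes a :: "real^'n"
  assumes S: "\<And>j k. 0 \<le> S $ j $ k" and z: "z \<in> uhp" and t: "t \<le> T"
  shows "Im z \<le> Im (char_flow a S T z t $ j)"
  using dyson_param_scaled_Im_ge[OF S const_vec_uhp[OF z] m_vec_solves[OF S const_vec_uhp[OF z]], of "exp ((t - T) / 2)" j] t
  by (simp add: char_flow_def const_vec_def[of z])

lemma char_flow_uhp:
  assumes "\<And>j k. 0 \<le> S $ j $ k" and "z \<in> uhp" and "t \<le> T"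
  shows "char_flow a S T z t \<in> uhp_vec"
  using char_flow_Im_ge[OF assms, of a] assms(2) by (auto simp: uhp_vec_def uhp_def intro: less_le_trans)

lemma scaleR_uhp_vec: "0 < s \<Longrightarrow> m \<in> uhp_vec \<Longrightarrow> s *\<^sub>R m \<in> uhp_vec"
  by (simp add: uhp_vec_def uhp_def)

lemma flow_solution_char_flow:
  fixes a :: "real^'n"
  assumes S: "\<And>j k. 0 \<le> S $ j $ k" and z: "z \<in> uhp"
  shows "flow_solution a S T z (char_flow a S T z)"
  unfolding flow_solution_def
proof (intro conjI ballI)
  note sol = m_vec_solves[OF S const_vec_uhp[OF z], of a]
  let ?m = "\<lambda>t. exp ((t - T) / 2) *\<^sub>R m_vec a S (const_vec z)"
  fix t assume "t \<in> {0..T}"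
  hence t: "t \<le> T" by simp
  show "char_flow a S T z t \<in> uhp_vec \<or> cnj_vec (char_flow a S T z t) \<in> uhp_vec"
    using char_flow_uhp[OF S z t] by simp
  have mt: "?m t \<in> uhp_vec" by (intro scaleR_uhp_vec sol) auto
  have m: "m_vec a S (char_flow a S T z t) = ?m t"
    by (rule m_vec_eqI[OF S char_flow_uhp[OF S z t] mt]) (simp add: dyson_eq_iff_param char_flow_def)
  have "(?m has_vector_derivative ((1 / 2) *\<^sub>R ?m t)) (at t within {0..T})"
    by (auto intro!: derivative_eq_intros simp: has_vector_derivative_def)
  hence "((dyson_param a S \<circ> ?m) has_vector_derivative dyson_param_deriv S (?m t) ((1 / 2) *\<^sub>R ?m t)) (at t within {0..T})"
    by (rule vector_derivative_diff_chain_within) (rule dyson_param_has_derivative[OF mt])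
  thus "(char_flow a S T z has_vector_derivative
      - S_apply S (m_vec a S (char_flow a S T z t)) - (1 / 2) *\<^sub>R (char_flow a S T z t - (\<chi> j. of_real (a $ j))))
      (at t within {0..T})"
    unfolding m flow_rhs_eq[OF char_flow_def] by (simp only: char_flow_def[abs_def] o_def)
next
  show "char_flow a S T z T = const_vec z"
    using m_vec_solves(2)[OF S const_vec_uhp[OF z], of a] by (simp add: char_flow_def dyson_eq_iff_param)
qed

text \<open>A solution lies in one of the two half-plane products at each time and starts, going backwards from
\<open>T\<close>, in the upper one. Leaving it would force a component through the real axis.\<close>

lemma flow_solution_stays_uhp:
  fixes Z :: "real \<Rightarrow> complex^'n"
  assumes z: "z \<in> uhp" and Z: "flow_solution a S T z Z" and t: "t \<in> {0..T}"
  shows "Z t \<in> uhp_vec"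
proof (rule ccontr)
  assume "Z t \<notin> uhp_vec"
  hence neg: "Im (Z t $ j) < 0" for j
    using Z t by (auto simp: flow_solution_def uhp_vec_def uhp_def cnj_vec_def)
  fix j :: 'n
  have "continuous_on {0..T} Z"
    using Z unfolding flow_solution_def continuous_on_eq_continuous_within
    by (auto dest: has_vector_derivative_continuous)
  hence "continuous_on {t..T} (\<lambda>s. Im (Z s $ j))"
    using t by (intro continuous_intros) (auto elim: continuous_on_subset)
  moreover have "0 \<le> Im (Z T $ j)"
    using Z z by (auto simp: flow_solution_def const_vec_def uhp_def)
  ultimately obtain s where s: "t \<le> s" "s \<le> T" "Im (Z s $ j) = 0"
    using IVT'[of "\<lambda>s. Im (Z s $ j)" t 0 T] neg[of j] t by force
  hence "Z s \<in> uhp_vec \<or> cnj_vec (Z s) \<in> uhp_vec"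
    using Z t by (auto simp: flow_solution_def)
  thus False using s by (auto simp: uhp_vec_def uhp_def cnj_vec_def dest!: spec[of _ j])
qed

text \<open>Along any solution \<open>Z\<close> the vector \<open>M(t) = m(Z(t))\<close> is differentiable by the chain rule, and
\<open>flow_rhs_eq\<close> gives \<open>M' = M/2\<close>. So \<open>M\<close> is determined by its value at \<open>T\<close>, and \<open>Z\<close> is
determined by \<open>M\<close>.\<close>

proposition flow_solution_unique:
  fixes a :: "real^'n"
  assumes S: "\<And>j k. 0 \<le> S $ j $ k" and z: "z \<in> uhp"
    and Z: "flow_solution a S T z Z" and t: "t \<in> {0..T}"
  shows "Z t = char_flow a S T z t"
proof -
  define M where "M = (\<lambda>s. m_vec a S (Z s))"
  have Zuhp: "Z s \<in> uhp_vec" if "s \<in> {0..T}" for s using flow_solution_stays_uhp[OF z Z that] .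
  have Z_eq: "Z s = dyson_param a S (M s)" if "s \<in> {0..T}" for s
    using m_vec_solves(2)[OF S Zuhp[OF that], of a] by (simp add: dyson_eq_iff_param M_def)
  have M': "(M has_vector_derivative (1 / 2) *\<^sub>R M s) (at s within {0..T})" if s: "s \<in> {0..T}" for s
  proof -
    obtain g' where g': "(m_vec a S has_derivative g') (at (Z s))"
        "\<And>h. g' (dyson_param_deriv S (m_vec a S (Z s)) h) = h"
      using m_vec_has_derivative[OF S Zuhp[OF s], of a] by metis
    have "(Z has_vector_derivative dyson_param_deriv S (M s) ((1 / 2) *\<^sub>R M s)) (at s within {0..T})"
      unfolding flow_rhs_eq[OF Z_eq[OF s], symmetric] unfolding M_def
      using Z s unfolding flow_solution_def by blast
    hence "((m_vec a S \<circ> Z) has_vector_derivative g' (dyson_param_deriv S (M s) ((1 / 2) *\<^sub>R M s))) (at s within {0..T})"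
      by (rule vector_derivative_diff_chain_within) (rule has_derivative_at_withinI[OF g'(1)])
    thus ?thesis using g'(2) by (simp add: M_def o_def)
  qed
  \<comment> \<open>An integrating factor turns \<open>M' = M/2\<close> into the constancy of a function.\<close>
  have "((\<lambda>s. exp (- s / 2) *\<^sub>R M s) has_vector_derivative 0) (at s within {0..T})" if "s \<in> {0..T}" for s
  proof -
    have "((\<lambda>s. exp (- s / 2)) has_real_derivative - (exp (- s / 2) / 2)) (at s within {0..T})"
      by (auto intro!: derivative_eq_intros)
    from has_vector_derivative_scaleR[OF this M'[OF that]] show ?thesis by (simp add: field_simps)
  qed
  then obtain c where c: "\<And>s. s \<in> {0..T} \<Longrightarrow> exp (- s / 2) *\<^sub>R M s = c"
    using has_vector_derivative_zero_constant[of "{0..T}" "\<lambda>s. exp (- s / 2) *\<^sub>R M s"] by auto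
  have T: "T \<in> {0..T}" using t by auto
  have MT: "M T = m_vec a S (const_vec z)" using Z by (simp add: M_def flow_solution_def)
  have "M t = exp (t / 2) *\<^sub>R (exp (- t / 2) *\<^sub>R M t)" by (simp flip: exp_add)
  also have "\<dots> = exp (t / 2) *\<^sub>R (exp (- T / 2) *\<^sub>R M T)" using c[OF t] c[OF T] by simp
  also have "\<dots> = exp ((t - T) / 2) *\<^sub>R M T" by (simp add: diff_divide_distrib flip: exp_add)
  finally show ?thesis using Z_eq[OF t] by (simp add: char_flow_def MT)
qed

lemma flow_map_eq_char_flow:
  fixes a :: "real^'n"
  assumes S: "\<And>j k. 0 \<le> S $ j $ k" and z: "z \<in> uhp" and t: "t \<in> {0..T}"
  shows "flow_map a S T t z = char_flow a S T z t"
  unfolding flow_map_def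
  using flow_solution_char_flow[OF S z] flow_solution_unique[OF S z _ t] by (intro the_equality) blast+

lemma holomorphic_char_flow:
  fixes a :: "real^'n"
  assumes S: "\<And>j k. 0 \<le> S $ j $ k"
  shows "(\<lambda>\<zeta>. char_flow a S T \<zeta> t $ j) holomorphic_on uhp"
proof -
  have "m_vec a S (const_vec \<zeta>) $ j \<noteq> 0" if "\<zeta> \<in> uhp" for \<zeta>
    using m_vec_solves(1)[OF S const_vec_uhp[OF that], of a] by (auto simp: uhp_vec_def uhp_def dest: spec[of _ j])
  thus ?thesis
    unfolding char_flow_def dyson_param_def S_apply_def
    by (auto intro!: holomorphic_intros holomorphic_m_vec_const S simp: scaleR_conv_of_real)
qed

section \<open>The generalized resolvent\<close>

text \<open>Conjugating the double sum and exchanging the order of summation gives it back.\<close>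

lemma quadratic_form_Hermitian_real:
  fixes X :: "complex^'n^'n"
  assumes "adj X = X"
  shows "Im (\<Sum>i\<in>UNIV. cnj (v $ i) * (X *v v) $ i) = 0"
proof -
  let ?q = "\<Sum>i\<in>UNIV. cnj (v $ i) * (X *v v) $ i"
  have X: "cnj (X $ i $ j) = X $ j $ i" for i j
    using assms by (auto simp: adj_def vec_eq_iff)
  have "cnj ?q = (\<Sum>i\<in>UNIV. \<Sum>j\<in>UNIV. v $ i * (X $ j $ i * cnj (v $ j)))"
    by (simp add: matrix_vector_mult_def sum_distrib_left X)
  also have "\<dots> = (\<Sum>j\<in>UNIV. \<Sum>i\<in>UNIV. v $ i * (X $ j $ i * cnj (v $ j)))"
    by (rule sum.swap)
  also have "\<dots> = ?q" by (simp add: matrix_vector_mult_def sum_distrib_left mult_ac)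
  finally have "Im (cnj ?q) = Im ?q" by (rule arg_cong)
  thus ?thesis by (simp only: cnj.sel)
qed

text \<open>The quadratic form of \<open>X - diag w\<close> at \<open>v\<close> has imaginary part \<open>-\<Sum> Im w\<^sub>i \<bar>v\<^sub>i\<bar>\<^sup>2\<close>, since that of \<open>X\<close>
is real; Cauchy-Schwarz bounds its modulus by \<open>\<parallel>v\<parallel> \<parallel>(X - diag w) v\<parallel>\<close>.\<close>

lemma resolvent_lower_bound:
  fixes X :: "complex^'n^'n"
  assumes X: "adj X = X" and w: "\<And>j. \<eta> \<le> Im (w $ j)" and "0 < \<eta>"
  shows "\<eta> * norm v \<le> norm ((X - diag_mat w) *v v)"
proof (cases "v = 0")
  case False
  let ?A = "X - diag_mat w"
  have A: "(?A *v v) $ i = (X *v v) $ i - w $ i * v $ i" for i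
    by (simp add: matrix_vector_mult_def diag_mat_def left_diff_distrib sum_subtractf
        if_distrib[of "\<lambda>x. x * _"] cong: if_cong)
  \<comment> \<open>The real inner product with \<open>\<i> v\<close> is the imaginary part of the Hermitian product with \<open>v\<close>.\<close>
  define iv where "iv = (\<chi> i. \<i> * v $ i)"
  have "\<eta> * (norm v)\<^sup>2 = (\<Sum>i\<in>UNIV. \<eta> * (cmod (v $ i))\<^sup>2)"
    by (simp add: norm_vec_def L2_set_def sum_nonneg sum_distrib_left)
  also have "\<dots> \<le> (\<Sum>i\<in>UNIV. Im (w $ i) * (cmod (v $ i))\<^sup>2)"
    using w by (intro sum_mono mult_right_mono) auto
  also have "\<dots> = - (\<Sum>i\<in>UNIV. Im (cnj (v $ i) * (?A *v v) $ i))"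
  proof -
    have "Im (cnj (v $ i) * (?A *v v) $ i) = Im (cnj (v $ i) * (X *v v) $ i) - Im (w $ i) * (cmod (v $ i))\<^sup>2" for i
      unfolding A cmod_power2 by (simp add: algebra_simps power2_eq_square)
    thus ?thesis using quadratic_form_Hermitian_real[OF X, of v] by (simp add: sum_subtractf)
  qed
  also have "\<dots> = - (iv \<bullet> (?A *v v))"
    by (simp add: inner_vec_def inner_complex_def iv_def algebra_simps)
  also have "\<dots> \<le> norm iv * norm (?A *v v)"
    using Cauchy_Schwarz_ineq2[of iv "?A *v v"] by linarith
  also have "norm iv = norm v"
    by (simp add: norm_vec_def iv_def norm_mult)
  finally have "norm v * (\<eta> * norm v) \<le> norm v * norm (?A *v v)" by (simp add: power2_eq_square mult_ac)
  thus ?thesis using False by simp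
qed simp

lemma resolvent_invertible:
  fixes X :: "complex^'n^'n"
  assumes "adj X = X" "w \<in> uhp_vec"
  shows "invertible (X - diag_mat w)"
proof -
  define \<eta> where "\<eta> = Min (range (\<lambda>j. Im (w $ j)))"
  have "0 < \<eta>" using assms(2) by (auto simp: \<eta>_def uhp_vec_def uhp_def)
  moreover have "\<eta> \<le> Im (w $ j)" for j by (simp add: \<eta>_def)
  ultimately have "(X - diag_mat w) *v v = 0 \<Longrightarrow> v = 0" for v
    using resolvent_lower_bound[OF assms(1), of \<eta> w v] by (simp add: mult_le_0_iff)
  thus ?thesis by (metis invertible_left_inverse matrix_left_invertible_ker)
qed

lemma gen_resolvent_right_inverse:
  fixes X :: "complex^'n^'n"
  assumes "adj X = X" "w \<in> uhp_vec"
  shows "(X - diag_mat w) *v (gen_resolvent X w *v v) = v"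
proof -
  have "(X - diag_mat w) ** gen_resolvent X w = mat 1"
    using someI_ex[OF resolvent_invertible[OF assms, unfolded invertible_def]]
    by (simp add: gen_resolvent_def matrix_inv_def)
  thus ?thesis by (simp add: matrix_vector_mul_assoc)
qed

lemma op_norm_gen_resolvent_le:
  fixes X :: "complex^'n^'n"
  assumes "adj X = X" and w: "\<And>j. \<eta> \<le> Im (w $ j)" and "0 < \<eta>"
  shows "op_norm (gen_resolvent X w) \<le> inverse \<eta>"
  unfolding op_norm_def
proof (rule onorm_bound)
  have "w \<in> uhp_vec" using w \<open>0 < \<eta>\<close> by (auto simp: uhp_vec_def uhp_def intro: less_le_trans)
  fix v
  have "\<eta> * norm (gen_resolvent X w *v v) \<le> norm v"
    using resolvent_lower_bound[OF assms, of "gen_resolvent X w *v v"]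
      gen_resolvent_right_inverse[OF assms(1) \<open>w \<in> uhp_vec\<close>] by simp
  thus "norm (gen_resolvent X w *v v) \<le> inverse \<eta> * norm v"
    using \<open>0 < \<eta>\<close> by (simp add: field_simps)
qed (use \<open>0 < \<eta>\<close> in auto)

lemma holomorphic_on_det:
  assumes "\<And>i j. (\<lambda>\<zeta>. A \<zeta> $ i $ j) holomorphic_on U"
  shows "(\<lambda>\<zeta>. det (A \<zeta> :: complex^'n^'n)) holomorphic_on U"
  unfolding det_def using assms by (intro holomorphic_intros) auto

text \<open>By Cramer's rule the entries of the inverse are quotients of determinants, hence holomorphic in the
entries of \<open>X - diag w\<close>.\<close>

lemma holomorphic_gen_resolvent:
  fixes X :: "complex^'n^'n"
  assumes X: "adj X = X" and w: "\<And>\<zeta>. \<zeta> \<in> U \<Longrightarrow> w \<zeta> \<in> uhp_vec"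
    and hol: "\<And>j. (\<lambda>\<zeta>. w \<zeta> $ j) holomorphic_on U"
  shows "(\<lambda>\<zeta>. gen_resolvent X (w \<zeta>) $ i $ j) holomorphic_on U"
proof -
  let ?A = "\<lambda>\<zeta>. X - diag_mat (w \<zeta>)"
  let ?B = "\<lambda>\<zeta>. (\<chi> k l. if l = i then axis j 1 $ k else ?A \<zeta> $ k $ l) :: complex^'n^'n"
  have A: "(\<lambda>\<zeta>. ?A \<zeta> $ k $ l) holomorphic_on U" for k l
    using hol by (cases "k = l") (auto simp: diag_mat_def intro!: holomorphic_intros)
  hence B: "(\<lambda>\<zeta>. ?B \<zeta> $ k $ l) holomorphic_on U" for k l
    by (cases "l = i") (auto intro!: holomorphic_intros)
  have nz: "det (?A \<zeta>) \<noteq> 0" if "\<zeta> \<in> U" for \<zeta>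
    using resolvent_invertible[OF X w[OF that]] by (simp add: invertible_det_nz)
  have eq: "det (?B \<zeta>) / det (?A \<zeta>) = gen_resolvent X (w \<zeta>) $ i $ j" if "\<zeta> \<in> U" for \<zeta>
  proof -
    have "gen_resolvent X (w \<zeta>) *v axis j 1 = (\<chi> i. det (\<chi> k l. if l = i then axis j 1 $ k else ?A \<zeta> $ k $ l) / det (?A \<zeta>))"
      using gen_resolvent_right_inverse[OF X w[OF that]] cramer[OF nz[OF that]] by blast
    moreover have "(gen_resolvent X (w \<zeta>) *v axis j 1) $ i = gen_resolvent X (w \<zeta>) $ i $ j"
      by (simp add: matrix_vector_mult_def axis_def if_distrib[of "\<lambda>x. _ * x"] cong: if_cong)
    ultimately show ?thesis by (metis (no_types, lifting) vec_lambda_beta)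
  qed
  have "(\<lambda>\<zeta>. det (?B \<zeta>) / det (?A \<zeta>)) holomorphic_on U"
    using nz by (intro holomorphic_intros holomorphic_on_det A B)
  thus ?thesis by (rule holomorphic_transform) (rule eq)
qed

section \<open>The two representation formulas\<close>

lemma cone_property_parameters:
  assumes "cone_property D \<gamma> \<omega> \<eta>" "z \<in> D"
  shows "0 < \<gamma>" "\<gamma> \<le> 1 / 4" "\<bar>\<omega> z\<bar> \<le> pi / 2 * \<gamma>"
proof -
  have "- (pi / 2 * \<gamma>) \<le> \<omega> z \<and> \<omega> z \<le> pi / 2 * \<gamma>"
    using assms by (simp add: cone_property_def)
  thus "\<bar>\<omega> z\<bar> \<le> pi / 2 * \<gamma>" by linarith
qed (use assms in \<open>auto simp: cone_property_def\<close>)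

theorem lemma4p11:
  shows
    "(\<forall>(D :: complex set) (\<gamma> :: real) (\<omega> :: complex \<Rightarrow> real) (\<eta>s :: real)
        (g :: complex \<Rightarrow> complex^'n^'n).
        D \<subseteq> uhp \<and> cone_property D \<gamma> \<omega> \<eta>s \<and>
        analytic_mat g uhp \<and>
        (\<exists>C. \<forall>\<zeta> \<in> D \<union> {\<zeta> \<in> uhp. \<bar>Im \<zeta>\<bar> \<ge> \<eta>s}. op_norm (g \<zeta>) \<le> C * inverse \<bar>Im \<zeta>\<bar>) \<longrightarrow>
        (\<forall>z \<in> D. \<forall>\<xi> \<in> {0 <..< Im z}.
          let \<psi> = psi \<gamma> \<omega> z \<xi>;
              F = (\<lambda>x :: real. cscale (1 / (of_real x - inv_into uhp \<psi> z)) (Im_mat (g (\<psi> (of_real x)))))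
          in integrable lborel F \<and>
             g z = (1 / pi) *\<^sub>R (LINT x|lborel. F x) \<and>
             \<psi> ` uhp_closed \<subseteq> uhp \<and>
             continuous_on uhp_closed \<psi> \<and>
             maps_conformally_onto \<psi> uhp
               (interior ({- \<i> * exp (\<i> * of_real (\<omega> z)) * of_real \<xi>} + tilted_cone \<gamma> (\<omega> z) z))))
     \<and>
     (\<forall>(a :: real^'n) (S :: real^'n^'n) (L :: nat) (C_a :: real) (c_inf :: real) (C_sup :: real)
        (C_m :: real) (\<rho>s :: real) (\<eta>s :: real) (\<epsilon> :: real) (T :: real)
        (\<gamma> :: real) (\<omega> :: complex \<Rightarrow> real) (\<eta>' :: real).
        model_assumptions a S L C_a c_inf C_sup C_m \<and>
        0 < \<rho>s \<and> 0 < \<eta>s \<and> 0 < \<epsilon> \<and>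
        cone_property (bulk_domain a S \<rho>s \<eta>s \<epsilon> \<inter> uhp) \<gamma> \<omega> \<eta>' \<longrightarrow>
        (\<forall>(X :: complex^'n^'n). adj X = X \<longrightarrow>
          (\<forall>t \<in> {0..T}. \<forall>z \<in> bulk_domain a S \<rho>s \<eta>s \<epsilon> \<inter> uhp. \<forall>\<xi> \<in> {0 <..< Im z}.
            let \<psi> = psi \<gamma> \<omega> z \<xi>;
                F = (\<lambda>x :: real. cscale (1 / (of_real x - \<i> * of_real (\<xi> powr (1 / \<gamma>))))
                       (Im_mat (gen_resolvent X ((flow_map a S T t \<circ> \<psi>) (of_real x)))))
            in integrable lborel F \<and>
               gen_resolvent X (flow_map a S T t z) = (1 / pi) *\<^sub>R (LINT x|lborel. F x))))"
proof (rule conjI; intro allI impI ballI)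
  fix D :: "complex set" and \<gamma> :: real and \<omega> :: "complex \<Rightarrow> real" and \<eta> :: real
    and g :: "complex \<Rightarrow> complex^'n^'n" and z :: complex and \<xi> :: real
  assume asm: "D \<subseteq> uhp \<and> cone_property D \<gamma> \<omega> \<eta> \<and> analytic_mat g uhp \<and>
    (\<exists>C. \<forall>\<zeta> \<in> D \<union> {\<zeta> \<in> uhp. \<bar>Im \<zeta>\<bar> \<ge> \<eta>}. op_norm (g \<zeta>) \<le> C * inverse \<bar>Im \<zeta>\<bar>)"
    and z: "z \<in> D" and "\<xi> \<in> {0 <..< Im z}"
  hence \<xi>: "0 < \<xi>" "\<xi> < Im z" by auto
  have \<gamma>: "0 < \<gamma>" "\<gamma> \<le> 1 / 4" and \<omega>: "\<bar>\<omega> z\<bar> \<le> pi / 2 * \<gamma>"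
    using asm z cone_property_parameters by blast+
  obtain C where "\<And>\<zeta>. 0 < Im \<zeta> \<Longrightarrow> \<eta> \<le> Im \<zeta> \<Longrightarrow> op_norm (g \<zeta>) \<le> C / Im \<zeta>"
    using asm that unfolding uhp_def divide_inverse by (metis (mono_tags, lifting) UnI2 abs_of_pos mem_Collect_eq)
  note rep = cone_integral_representation[where g = g and \<omega> = \<omega> and z = z, OF \<gamma> \<omega> \<xi> _ this]
  have g: "analytic_mat g uhp" using asm by blast
  have "inv_into uhp (psi \<gamma> \<omega> z \<xi>) z = \<i> * of_real (\<xi> powr (1 / \<gamma>))"
    using \<gamma> \<xi> by (intro inv_into_psi) auto
  moreover have "psi \<gamma> \<omega> z \<xi> ` uhp_closed \<subseteq> uhp"
    using psi_uhp[where \<omega> = \<omega> and z = z, OF \<gamma> \<omega> \<xi>] by auto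
  moreover have "maps_conformally_onto (psi \<gamma> \<omega> z \<xi>) uhp
      (interior ({- \<i> * exp (\<i> * of_real (\<omega> z)) * of_real \<xi>} + tilted_cone \<gamma> (\<omega> z) z))"
    unfolding maps_conformally_onto_def using \<gamma> \<xi> by (intro conjI holomorphic_on_psi bij_betw_psi) auto
  ultimately show "let \<psi> = psi \<gamma> \<omega> z \<xi>;
      F = (\<lambda>x :: real. cscale (1 / (of_real x - inv_into uhp \<psi> z)) (Im_mat (g (\<psi> (of_real x)))))
    in integrable lborel F \<and> g z = (1 / pi) *\<^sub>R (LINT x|lborel. F x) \<and>
      \<psi> ` uhp_closed \<subseteq> uhp \<and> continuous_on uhp_closed \<psi> \<and>
      maps_conformally_onto \<psi> uhp
        (interior ({- \<i> * exp (\<i> * of_real (\<omega> z)) * of_real \<xi>} + tilted_cone \<gamma> (\<omega> z) z))"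
    unfolding Let_def using rep[OF g] continuous_on_psi[OF \<gamma>(1)] by simp
next
  fix a :: "real^'n" and S :: "real^'n^'n" and L :: nat and C_a c_inf C_sup C_m \<rho>s \<eta>s \<epsilon> T \<gamma> :: real
    and \<omega> :: "complex \<Rightarrow> real" and \<eta>' :: real and X :: "complex^'n^'n" and t :: real and z :: complex and \<xi> :: real
  assume asm: "model_assumptions a S L C_a c_inf C_sup C_m \<and> 0 < \<rho>s \<and> 0 < \<eta>s \<and> 0 < \<epsilon> \<and>
        cone_property (bulk_domain a S \<rho>s \<eta>s \<epsilon> \<inter> uhp) \<gamma> \<omega> \<eta>'"
    and X: "adj X = X" and t: "t \<in> {0..T}" and z: "z \<in> bulk_domain a S \<rho>s \<eta>s \<epsilon> \<inter> uhp" and "\<xi> \<in> {0 <..< Im z}"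
  hence \<xi>: "0 < \<xi>" "\<xi> < Im z" by auto
  have \<gamma>: "0 < \<gamma>" "\<gamma> \<le> 1 / 4" and \<omega>: "\<bar>\<omega> z\<bar> \<le> pi / 2 * \<gamma>"
    using asm z cone_property_parameters by blast+
  have S: "\<And>j k. 0 \<le> S $ j $ k" using asm by (simp add: model_assumptions_def)
  have t': "t \<le> T" using t by simp
  let ?g = "\<lambda>\<zeta>. gen_resolvent X (char_flow a S T \<zeta> t)"
  have flow: "flow_map a S T t \<zeta> = char_flow a S T \<zeta> t" if "\<zeta> \<in> uhp" for \<zeta>
    by (rule flow_map_eq_char_flow[OF S that t])
  have g: "analytic_mat ?g uhp"
    unfolding analytic_mat_def
    by (intro allI holomorphic_gen_resolvent[OF X] char_flow_uhp holomorphic_char_flow S t')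
  \<comment> \<open>The bound holds in the whole half-plane, so the threshold is taken to be \<open>0\<close>.\<close>
  have decay: "op_norm (?g \<zeta>) \<le> 1 / Im \<zeta>" if "0 < Im \<zeta>" "0 \<le> Im \<zeta>" for \<zeta>
    using op_norm_gen_resolvent_le[OF X char_flow_Im_ge[OF S _ t'], of \<zeta> a] that
    by (simp add: uhp_def divide_inverse)
  note rep = cone_integral_representation[where g = ?g and \<omega> = \<omega> and z = z, OF \<gamma> \<omega> \<xi> g decay]
  have psi: "psi \<gamma> \<omega> z \<xi> (of_real x) \<in> uhp" for x
    by (rule psi_uhp) (use \<gamma> \<omega> \<xi> in \<open>auto simp: uhp_closed_def\<close>)
  show "let \<psi> = psi \<gamma> \<omega> z \<xi>;
      F = (\<lambda>x :: real. cscale (1 / (of_real x - \<i> * of_real (\<xi> powr (1 / \<gamma>))))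
             (Im_mat (gen_resolvent X ((flow_map a S T t \<circ> \<psi>) (of_real x)))))
    in integrable lborel F \<and>
      gen_resolvent X (flow_map a S T t z) = (1 / pi) *\<^sub>R (LINT x|lborel. F x)"
    unfolding Let_def o_def flow[OF psi] using rep flow[of z] z by simp
qed

end
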